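(* Let $G$ be a finite simple biconnected graph which is complete intersection. Then $G$ satisfies the odd cycle condition, and consequently the edge ring $K[G]$ is normal.
   Context: A graph is biconnected if it is connected and has no cut vertex. For a finite simple graph $G$ with edges $e_1,\dots,e_m$ and a field $K$, the toric ideal $I_G\subseteq K[e_1,\dots,e_m]$ is the kernel of the $K$-algebra map $e_i=\{v_j,v_k\}\mapsto v_jv_k$; $G$ is complete intersection if $I_G$ is generated by $\operatorname{ht}(I_G)$ elements. The edge ring $K[G]$ is the subalgebra of $K[v_1,\dots,v_n]$ generated by the monomials $v_iv_j$ with $\{v_i,v_j\}\in E(G)$. A cycle is chordless if no edge of $G$ joins two of its vertices other than its own edges. $G$ satisfies the odd cycle condition if for any two odd chordless cycles $c_1,c_2$ of $G$, either $c_1$ and $c_2$ have a common vertex or some edge of $G$ joins a vertex of $c_1$ to a vertex of $c_2$. *)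

theory Defs
  imports "HOL-Library.Poly_Mapping" "HOL-Library.Extended_Nat"
begin

text \<open>A finite simple graph: vertices are the elements of a finite type 'v, edges the
elements of a finite type 'e; ends e is the two-element vertex set of edge e, and distinct
edges have distinct end sets.\<close>

definition simple_graph :: "('e::finite \<Rightarrow> 'v::finite set) \<Rightarrow> bool" where
  "simple_graph ends \<longleftrightarrow> inj ends \<and> (\<forall>e. card (ends e) = 2)"

definition adj :: "('e \<Rightarrow> 'v set) \<Rightarrow> 'v \<Rightarrow> 'v \<Rightarrow> bool" where
  "adj ends u w \<longleftrightarrow> (\<exists>e. ends e = {u, w}) \<and> u \<noteq> w"

definition reach_in :: "('e \<Rightarrow> 'v set) \<Rightarrow> 'v set \<Rightarrow> 'v \<Rightarrow> 'v \<Rightarrow> bool" where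
  "reach_in ends S = (\<lambda>a b. a \<in> S \<and> b \<in> S \<and> adj ends a b)\<^sup>*\<^sup>*"

definition connected_graph :: "('e \<Rightarrow> 'v set) \<Rightarrow> bool" where
  "connected_graph ends \<longleftrightarrow> (\<forall>u w. reach_in ends UNIV u w)"

text \<open>x is a cut vertex iff its removal increases the number of connected components,
i.e. two vertices different from x that are connected in G are disconnected in G - x.\<close>
definition cut_vertex :: "('e \<Rightarrow> 'v set) \<Rightarrow> 'v \<Rightarrow> bool" where
  "cut_vertex ends x \<longleftrightarrow> (\<exists>u w. u \<noteq> x \<and> w \<noteq> x \<and> reach_in ends UNIV u w
                                 \<and> \<not> reach_in ends (UNIV - {x}) u w)"

definition biconnected :: "('e \<Rightarrow> 'v set) \<Rightarrow> bool" where
  "biconnected ends \<longleftrightarrow> connected_graph ends \<and> (\<forall>x. \<not> cut_vertex ends x)"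

definition is_cycle :: "('e \<Rightarrow> 'v set) \<Rightarrow> 'v list \<Rightarrow> bool" where
  "is_cycle ends c \<longleftrightarrow> length c \<ge> 3 \<and> distinct c \<and>
     (\<forall>i < length c. adj ends (c ! i) (c ! ((i + 1) mod length c)))"

definition chordless_cycle :: "('e \<Rightarrow> 'v set) \<Rightarrow> 'v list \<Rightarrow> bool" where
  "chordless_cycle ends c \<longleftrightarrow> is_cycle ends c \<and>
     (\<forall>i < length c. \<forall>j < length c. adj ends (c ! i) (c ! j) \<longrightarrow>
        j = (i + 1) mod length c \<or> i = (j + 1) mod length c)"

definition odd_cycle_condition :: "('e \<Rightarrow> 'v set) \<Rightarrow> bool" where
  "odd_cycle_condition ends \<longleftrightarrow>
     (\<forall>c1 c2. chordless_cycle ends c1 \<and> odd (length c1) \<and>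
              chordless_cycle ends c2 \<and> odd (length c2) \<longrightarrow>
        set c1 \<inter> set c2 \<noteq> {} \<or> (\<exists>u \<in> set c1. \<exists>w \<in> set c2. adj ends u w))"

type_synonym ('x, 'k) mpoly = "('x \<Rightarrow>\<^sub>0 nat) \<Rightarrow>\<^sub>0 'k"

definition is_ideal :: "'r::comm_ring_1 set \<Rightarrow> bool" where
  "is_ideal I \<longleftrightarrow> 0 \<in> I \<and> (\<forall>a\<in>I. \<forall>b\<in>I. a + b \<in> I) \<and> (\<forall>a\<in>I. \<forall>r. r * a \<in> I)"

definition ideal_gen :: "'r::comm_ring_1 set \<Rightarrow> 'r set" where
  "ideal_gen S = \<Inter>{I. is_ideal I \<and> S \<subseteq> I}"

definition prime_ideal :: "'r::comm_ring_1 set \<Rightarrow> bool" where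
  "prime_ideal P \<longleftrightarrow> is_ideal P \<and> P \<noteq> UNIV \<and> (\<forall>a b. a * b \<in> P \<longrightarrow> a \<in> P \<or> b \<in> P)"

definition prime_height :: "'r::comm_ring_1 set \<Rightarrow> enat" where
  "prime_height P = Sup {enat n | n. \<exists>C :: nat \<Rightarrow> 'r set.
       (\<forall>i \<le> n. prime_ideal (C i)) \<and> (\<forall>i < n. C i \<subset> C (Suc i)) \<and> C n = P}"

definition ideal_height :: "'r::comm_ring_1 set \<Rightarrow> enat" where
  "ideal_height I = Inf {prime_height P | P. prime_ideal P \<and> I \<subseteq> P}"

text \<open>Exponent vector in the vertex variables of the image of an edge monomial:
 e_1^{a_1}...e_m^{a_m} maps to \<Prod> (v_j v_k)^{a_i}.\<close>
definition vertex_exp :: "('e \<Rightarrow> 'v set) \<Rightarrow> ('e \<Rightarrow>\<^sub>0 nat) \<Rightarrow> ('v \<Rightarrow>\<^sub>0 nat)" where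
  "vertex_exp ends a = (\<Sum>e\<in>Poly_Mapping.keys a. \<Sum>v\<in>ends e. Poly_Mapping.single v (Poly_Mapping.lookup a e))"

text \<open>The K-algebra map K[e_1..e_m] -> K[v_1..v_n], e = {v_j,v_k} |-> v_j v_k.\<close>
definition toric_map :: "('e \<Rightarrow> 'v set) \<Rightarrow> ('e, 'k::field) mpoly \<Rightarrow> ('v, 'k) mpoly" where
  "toric_map ends p = (\<Sum>a\<in>Poly_Mapping.keys p. Poly_Mapping.single (vertex_exp ends a) (Poly_Mapping.lookup p a))"

definition toric_ideal :: "('e \<Rightarrow> 'v set) \<Rightarrow> ('e, 'k::field) mpoly set" where
  "toric_ideal ends = {p. toric_map ends p = 0}"

definition complete_intersection :: "('e::finite \<Rightarrow> 'v::finite set) \<Rightarrow> 'k::field itself \<Rightarrow> bool" where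
  "complete_intersection ends _ \<longleftrightarrow>
     (\<exists>gs :: ('e, 'k) mpoly list. enat (length gs) = ideal_height (toric_ideal ends :: ('e,'k) mpoly set)
        \<and> toric_ideal ends = ideal_gen (set gs))"

inductive_set edge_ring :: "('e \<Rightarrow> 'v set) \<Rightarrow> ('v, 'k::field) mpoly set" for ends where
  const: "Poly_Mapping.single 0 c \<in> edge_ring ends"
| gen: "Poly_Mapping.single (\<Sum>v\<in>ends e. Poly_Mapping.single v 1) 1 \<in> edge_ring ends"
| add: "p \<in> edge_ring ends \<Longrightarrow> q \<in> edge_ring ends \<Longrightarrow> p + q \<in> edge_ring ends"
| mult: "p \<in> edge_ring ends \<Longrightarrow> q \<in> edge_ring ends \<Longrightarrow> p * q \<in> edge_ring ends"

text \<open>A subring S of a domain is normal iff it is integrally closed in its fraction field: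
 whenever a/b (a, b in S, b nonzero) satisfies a monic equation
 x^n + c_{n-1} x^{n-1} + ... + c_0 = 0 with c_i in S, then a/b lies in S.
 Multiplying through by b^n this is stated inside the ambient ring.\<close>
definition normal_subring :: "'r::comm_ring_1 set \<Rightarrow> bool" where
  "normal_subring S \<longleftrightarrow>
     (\<forall>a\<in>S. \<forall>b\<in>S. b \<noteq> 0 \<longrightarrow>
        (\<exists>n > 0. \<exists>c :: nat \<Rightarrow> 'r. (\<forall>i < n. c i \<in> S) \<and>
            a ^ n + (\<Sum>i<n. c i * a ^ i * b ^ (n - i)) = 0) \<longrightarrow>
        (\<exists>d\<in>S. a = b * d))"

end

theory Submission
  imports Defs Complex_Main "HOL-Library.Cardinality" "HOL-Library.FuncSet" "HOL-Library.Multiset"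
    "HOL-Combinatorics.Cycles"
begin

text \<open>
  Let $A u$ be the vertex degree of an edge monomial $u$, and call the set of all monomials of a given
  degree a fiber. Two monomials of a fiber are linked if a chain in the fiber joins them in which
  consecutive monomials share an edge. The number of classes minus one, summed over all fibers, is a
  lower bound for the number of generators of the toric ideal $I$, because class sums are linear forms
  that vanish on the product of $I$ with the irrelevant ideal. On the other hand a chain of primes
  below $I$ yields algebraically independent polynomials, so the height of $I$ is at most the rank of
  the kernel lattice of $A$. Hence for a complete intersection the moves between classes form a basis
  of this lattice over the rationals, and no proper subset of them spans it.

  Let $C_1$, $C_2$ be disjoint odd cycles without an edge between them, and let $x$ be a vertex outside
  both. As $G - x$ is connected and contains an odd cycle, the lattice is already spanned by differences
  of monomials whose common degree at $x$ is at most $1$; so every move has degree at most $1$ at $x$.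
  Choose $x$ as the last vertex adjacent to $C_1$ on a path from $C_1$ to $C_2$. In the fiber of the
  even closed walk around $C_1$, along the path, around $C_2$ and back, every edge leaving $C_1$ goes
  to $x$. The number of these edges is even, and a move changes it by at most one, so it is constant.
  But one of the two monomials of the walk has two such edges and the other has none.

  For normality, the leading exponent of a fraction that is almost integral over $K[G]$ satisfies
  Hall's condition, which turns it into a sum of closed walks. Even closed walks lie in the edge
  semigroup, and by the odd cycle condition so does the sum of any two odd ones. One subtracts the
  leading term and proceeds by induction.
\<close>

declare One_nat_def [simp del]

abbreviation lookup where "lookup \<equiv> Poly_Mapping.lookup"
abbreviation keys where "keys \<equiv> Poly_Mapping.keys"
abbreviation single where "single \<equiv> Poly_Mapping.single"

subsection \<open>Linear systems and linear forms on polynomials\<close>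

text \<open>Gaussian elimination by induction on the equations: an equation with a nonzero
  coefficient is solved for one unknown, and the rest of the system loses one equation and one
  unknown.\<close>

lemma underdetermined_system_nontrivial:
  fixes a :: "'i \<Rightarrow> 'z \<Rightarrow> 'k::field"
  assumes "finite I" "finite Z" "card I < card Z"
  shows "\<exists>c. (\<exists>z\<in>Z. c z \<noteq> 0) \<and> (\<forall>i\<in>I. (\<Sum>z\<in>Z. a i z * c z) = 0)"
  using assms
proof (induction I arbitrary: Z a rule: finite_induct)
  case empty
  then obtain z where "z \<in> Z" by fastforce
  then show ?case by (intro exI[of _ "\<lambda>_. 1"]) auto
next
  case (insert i I)
  show ?case
  proof (cases "\<forall>z\<in>Z. a i z = 0")
    case True
    have "card I < card Z" using insert by simp
    with insert.IH[OF insert.prems(1)] True show ?thesis by fastforce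
  next
    case False
    then obtain z0 where z0: "z0 \<in> Z" "a i z0 \<noteq> 0" by blast
    define Z' where "Z' = Z - {z0}"
    have Z': "finite Z'" "card I < card Z'" "z0 \<notin> Z'" "Z = insert z0 Z'"
      using insert z0 by (auto simp: Z'_def)
    \<comment> \<open>Row operation that removes the unknown \<open>z0\<close> from equation
      \<open>j\<close>.\<close>
    define a' where "a' = (\<lambda>j z. a j z - a j z0 * a i z / a i z0)"
    from insert.IH[OF Z'(1,2), of a'] obtain c where
      c: "\<exists>z\<in>Z'. c z \<noteq> 0" "\<And>j. j \<in> I \<Longrightarrow> (\<Sum>z\<in>Z'. a' j z * c z) = 0" by blast
    define r where "r = - (\<Sum>z\<in>Z'. a i z * c z) / a i z0"
    define d where "d = c(z0 := r)"
    have sumd: "(\<Sum>z\<in>Z. a j z * d z) = a j z0 * r + (\<Sum>z\<in>Z'. a j z * c z)" for j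
    proof -
      have "(\<Sum>z\<in>Z'. a j z * d z) = (\<Sum>z\<in>Z'. a j z * c z)"
        using Z'(3) by (intro sum.cong) (auto simp: d_def)
      then show ?thesis using Z' by (simp add: d_def)
    qed
    have "(\<Sum>z\<in>Z. a j z * d z) = 0" if "j \<in> insert i I" for j
    proof (cases "j = i")
      case True
      then show ?thesis using z0 by (simp add: sumd r_def)
    next
      case False
      with that have "j \<in> I" by simp
      then have "0 = (\<Sum>z\<in>Z'. a j z * c z) - a j z0 / a i z0 * (\<Sum>z\<in>Z'. a i z * c z)"
        using c(2)[of j]
        by (simp add: a'_def algebra_simps sum_subtractf sum_distrib_left sum_distrib_right sum_divide_distrib)
      then show ?thesis by (simp add: sumd r_def)
    qed
    moreover have "\<exists>z\<in>Z. d z \<noteq> 0"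
      using c(1) Z' by (auto simp: d_def)
    ultimately show ?thesis by blast
  qed
qed

lemma sum_single_keys: "(\<Sum>a\<in>keys p. single a (lookup p a)) = p"
proof (rule poly_mapping_eqI)
  fix b
  have "lookup (\<Sum>a\<in>keys p. single a (lookup p a)) b = (\<Sum>a\<in>keys p. lookup p a when a = b)"
    by (simp add: lookup_sum lookup_single)
  also have "\<dots> = lookup p b"
    by (auto simp: when_def in_keys_iff)
  finally show "lookup (\<Sum>a\<in>keys p. single a (lookup p a)) b = lookup p b" .
qed

lemma poly_mapping_add_induct [case_names single add]:
  fixes p :: "'a \<Rightarrow>\<^sub>0 'b::comm_monoid_add"
  assumes "\<And>a k. P (single a k)" and "\<And>p q. P p \<Longrightarrow> P q \<Longrightarrow> P (p + q)"
  shows "P p"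
proof -
  have "P (\<Sum>a\<in>A. single a (lookup p a))" if "finite A" for A
    using that
  proof (induction A rule: finite_induct)
    case empty
    then show ?case using assms(1)[of undefined 0] by simp
  qed (auto intro: assms)
  from this[of "keys p"] show ?thesis by (simp add: sum_single_keys)
qed

section \<open>Linear forms given by their values on monomials\<close>

definition lin_ext :: "('a \<Rightarrow> 'k) \<Rightarrow> ('a \<Rightarrow>\<^sub>0 'k::comm_ring_1) \<Rightarrow> 'k" where
  "lin_ext w p = (\<Sum>a\<in>keys p. lookup p a * w a)"

lemma lin_ext_superset:
  assumes "finite A" "keys p \<subseteq> A"
  shows "lin_ext w p = (\<Sum>a\<in>A. lookup p a * w a)"
  unfolding lin_ext_def using assms
  by (intro sum.mono_neutral_left) (auto simp: in_keys_iff)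

lemma lin_ext_0 [simp]: "lin_ext w 0 = 0"
  by (simp add: lin_ext_def)

lemma lin_ext_single [simp]: "lin_ext w (single a k) = k * w a"
  using lin_ext_superset[of "{a}" "single a k" w] by simp

lemma lin_ext_add: "lin_ext w (p + q) = lin_ext w p + lin_ext w q"
proof -
  have "keys (p + q) \<subseteq> keys p \<union> keys q" by (rule keys_add)
  then show ?thesis
    by (simp add: lin_ext_superset[of "keys p \<union> keys q"] lookup_add algebra_simps sum.distrib)
qed

lemma lin_ext_uminus: "lin_ext w (- p) = - lin_ext w p"
  by (metis add.right_inverse add_eq_0_iff lin_ext_0 lin_ext_add)

lemma lin_ext_diff: "lin_ext w (p - q) = lin_ext w p - lin_ext w q"
  using lin_ext_add[of w p "- q"] by (simp add: lin_ext_uminus)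

lemma lin_ext_sum: "lin_ext w (sum f A) = (\<Sum>i\<in>A. lin_ext w (f i))"
  by (induction A rule: infinite_finite_induct) (auto simp: lin_ext_add)

lemma lin_ext_single_mult:
  "lin_ext w (single c k * p) = k * lin_ext (\<lambda>a. w (c + a)) p"
  by (induction p rule: poly_mapping_add_induct)
     (auto simp: lin_ext_add mult_single algebra_simps)

lemma lin_ext_indicator: "lin_ext (\<lambda>a. if a = b then 1 else 0) p = lookup p b"
  by (induction p rule: poly_mapping_add_induct)
     (auto simp: lin_ext_add lookup_add lookup_single when_def)

lemma lookup_scale: "lookup (single 0 k * p) b = k * lookup p b"
  for p :: "'a::comm_monoid_add \<Rightarrow>\<^sub>0 'k::comm_ring_1"
  using lin_ext_single_mult[of "\<lambda>a. if a = b then 1 else 0" 0 k p]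
  by (simp add: lin_ext_indicator)

subsection \<open>The toric ideal\<close>

lemma lookup_vertex_exp:
  fixes ends :: "'e::finite \<Rightarrow> 'v::finite set"
  shows "lookup (vertex_exp ends a) v = (\<Sum>e | v \<in> ends e. lookup a e)"
proof -
  have "lookup (vertex_exp ends a) v = (\<Sum>e\<in>keys a. \<Sum>x\<in>ends e. (lookup a e when x = v))"
    by (simp add: vertex_exp_def lookup_sum lookup_single)
  also have "\<dots> = (\<Sum>e\<in>keys a. if v \<in> ends e then lookup a e else 0)"
    by (intro sum.cong) (auto simp: when_def)
  also have "\<dots> = (\<Sum>e\<in>UNIV. if v \<in> ends e then lookup a e else 0)"
    by (intro sum.mono_neutral_left) (auto simp: in_keys_iff)
  also have "\<dots> = (\<Sum>e | v \<in> ends e. lookup a e)"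
    by (simp add: sum.If_cases)
  finally show ?thesis .
qed

lemma vertex_exp_add:
  fixes ends :: "'e::finite \<Rightarrow> 'v::finite set"
  shows "vertex_exp ends (a + b) = vertex_exp ends a + vertex_exp ends b"
  by (rule poly_mapping_eqI) (simp add: lookup_vertex_exp lookup_add sum.distrib)

lemma vertex_exp_0 [simp]: "vertex_exp ends 0 = 0"
  by (simp add: vertex_exp_def)

lemma vertex_exp_single:
  "vertex_exp ends (single e n) = (\<Sum>v\<in>ends e. single v n)"
  by (cases "n = 0") (simp_all add: vertex_exp_def)

text \<open>The transpose of the toric map is composition with \<open>vertex_exp\<close>. Hence a
  linear form that is constant on fibers factors through the map and vanishes on its kernel.\<close>

lemma lin_ext_toric_map: "lin_ext h (toric_map ends p) = lin_ext (\<lambda>a. h (vertex_exp ends a)) p"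
  by (simp add: toric_map_def lin_ext_sum) (simp add: lin_ext_def)

text \<open>Reading off one coefficient is a linear form, so linear forms separate polynomials;
  identities for \<open>toric_map\<close> are proved by testing against them.\<close>

lemma lin_ext_eqI: "(\<And>h. lin_ext h p = lin_ext h q) \<Longrightarrow> p = q"
  by (metis lin_ext_indicator poly_mapping_eqI)

lemma toric_map_single: "toric_map ends (single a k) = single (vertex_exp ends a) k"
  by (rule lin_ext_eqI) (simp add: lin_ext_toric_map)

lemma toric_map_add: "toric_map ends (p + q) = toric_map ends p + toric_map ends q"
  by (rule lin_ext_eqI) (simp add: lin_ext_toric_map lin_ext_add)

lemma toric_map_mult:
  fixes ends :: "'e::finite \<Rightarrow> 'v::finite set"
  shows "toric_map ends (p * q) = toric_map ends p * toric_map ends q"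
proof (induction p rule: poly_mapping_add_induct)
  case (single a k)
  show ?case
    by (induction q rule: poly_mapping_add_induct)
       (auto simp: mult_single toric_map_single toric_map_add vertex_exp_add algebra_simps)
qed (simp add: toric_map_add algebra_simps)

lemma toric_ideal_lin_ext:
  "p \<in> toric_ideal ends \<Longrightarrow> lin_ext (\<lambda>a. h (vertex_exp ends a)) p = 0"
  using lin_ext_toric_map[of h ends p] by (simp add: toric_ideal_def)

lemma is_ideal_toric_ideal:
  fixes ends :: "'e::finite \<Rightarrow> 'v::finite set"
  shows "is_ideal (toric_ideal ends :: ('e, 'k::field) mpoly set)"
  by (auto simp: is_ideal_def toric_ideal_def toric_map_add toric_map_mult)
     (simp add: toric_map_def)

lemma binomial_in_toric_ideal:
  assumes "vertex_exp ends u = vertex_exp ends u'"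
  shows "single u 1 - single u' 1 \<in> toric_ideal ends"
proof -
  have "toric_map ends (single u 1 - single u' 1) = 0"
    by (rule lin_ext_eqI) (simp add: lin_ext_toric_map lin_ext_diff assms)
  then show ?thesis by (simp add: toric_ideal_def)
qed

lemma ideal_gen_subset: "is_ideal J \<Longrightarrow> S \<subseteq> J \<Longrightarrow> ideal_gen S \<subseteq> J"
  by (auto simp: ideal_gen_def)

subsection \<open>Leading exponents\<close>

text \<open>On finitely supported functions the library order is lexicographic with the smallest index most
  significant, so placing the total degree at index $0$ makes every initial segment finite.\<close>
definition grlex_key :: "('v::finite \<Rightarrow>\<^sub>0 nat) \<Rightarrow> (nat \<Rightarrow>\<^sub>0 nat)" where
  "grlex_key u = single 0 (\<Sum>v\<in>UNIV. lookup u v) + (\<Sum>v\<in>UNIV. single (Suc (to_nat v)) (lookup u v))"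

lemma grlex_key_add: "grlex_key (u + w) = grlex_key u + grlex_key w"
  by (simp add: grlex_key_def lookup_add sum.distrib single_add algebra_simps)

lemma lookup_grlex_key_0: "lookup (grlex_key u) 0 = (\<Sum>v\<in>UNIV. lookup u v)"
  by (simp add: grlex_key_def lookup_add lookup_sum lookup_single)

lemma lookup_grlex_key_Suc: "lookup (grlex_key u) (Suc (to_nat v)) = lookup u v"
  by (simp add: grlex_key_def lookup_add lookup_sum lookup_single when_def)

lemma inj_grlex_key: "inj grlex_key"
  by (rule injI, rule poly_mapping_eqI) (metis lookup_grlex_key_Suc)

lemma finite_bounded_exponents:
  "finite {u :: 'v::finite \<Rightarrow>\<^sub>0 nat. \<forall>v. lookup u v \<le> d}"
  and card_bounded_exponents:
  "card {u :: 'v::finite \<Rightarrow>\<^sub>0 nat. \<forall>v. lookup u v \<le> d} \<le> (d + 1) ^ CARD('v)"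
proof -
  let ?B = "{u :: 'v \<Rightarrow>\<^sub>0 nat. \<forall>v. lookup u v \<le> d}"
  let ?F = "(UNIV :: 'v set) \<rightarrow>\<^sub>E {..d}"
  have inj: "inj_on lookup ?B" by (auto intro!: inj_onI poly_mapping_eqI)
  have sub: "lookup ` ?B \<subseteq> ?F" by auto
  have fin: "finite ?F" by (auto intro: finite_PiE)
  show "finite ?B" by (rule inj_on_finite[OF inj sub fin])
  have "card ?B \<le> card ?F" by (rule card_inj_on_le[OF inj sub fin])
  also have "card ?F = (d + 1) ^ CARD('v)" by (simp add: card_PiE One_nat_def)
  finally show "card ?B \<le> (d + 1) ^ CARD('v)" .
qed

lemma finite_grlex_below: "finite {y :: 'v::finite \<Rightarrow>\<^sub>0 nat. grlex_key y < grlex_key (x :: 'v \<Rightarrow>\<^sub>0 nat)}"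
proof (rule finite_subset[OF _ finite_bounded_exponents])
  show "{y. grlex_key y < grlex_key x} \<subseteq> {y. \<forall>v. lookup y v \<le> lookup (grlex_key x) 0}"
  proof clarify
    fix y v assume "grlex_key y < grlex_key x"
    then have "less_fun (lookup (grlex_key y)) (lookup (grlex_key x))"
      by (simp add: less_poly_mapping.rep_eq)
    then have "lookup (grlex_key y) 0 \<le> lookup (grlex_key x) 0"
      by (metis gr0I less_funE order.strict_iff_not order_refl)
    moreover have "lookup y v \<le> lookup (grlex_key y) 0"
      unfolding lookup_grlex_key_0 by (rule member_le_sum) auto
    ultimately show "lookup y v \<le> lookup (grlex_key x) 0" by linarith
  qed
qed

definition lead_exp :: "(('v::finite \<Rightarrow>\<^sub>0 nat) \<Rightarrow>\<^sub>0 'k::zero) \<Rightarrow> ('v \<Rightarrow>\<^sub>0 nat)" where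
  "lead_exp p = (SOME u. u \<in> keys p \<and> (\<forall>w\<in>keys p. grlex_key w \<le> grlex_key u))"

lemma lead_exp:
  assumes "p \<noteq> 0"
  shows "lead_exp p \<in> keys p" and "\<And>w. w \<in> keys p \<Longrightarrow> grlex_key w \<le> grlex_key (lead_exp p)"
proof -
  have "finite (grlex_key ` keys p)" "grlex_key ` keys p \<noteq> {}" using assms by auto
  from Max_in[OF this] obtain u where "u \<in> keys p" "grlex_key u = Max (grlex_key ` keys p)" by auto
  then have "u \<in> keys p \<and> (\<forall>w\<in>keys p. grlex_key w \<le> grlex_key u)" by simp
  then have "lead_exp p \<in> keys p \<and> (\<forall>w\<in>keys p. grlex_key w \<le> grlex_key (lead_exp p))"
    unfolding lead_exp_def by (rule someI)
  then show "lead_exp p \<in> keys p" and "\<And>w. w \<in> keys p \<Longrightarrow> grlex_key w \<le> grlex_key (lead_exp p)"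
    by auto
qed

lemma lead_exp_eqI:
  assumes "u \<in> keys p" "\<And>w. w \<in> keys p \<Longrightarrow> grlex_key w \<le> grlex_key u"
  shows "lead_exp p = u"
proof -
  have "p \<noteq> 0" using assms(1) by auto
  then have "grlex_key (lead_exp p) = grlex_key u"
    using lead_exp[of p] assms by (meson order_antisym)
  then show ?thesis by (rule injD[OF inj_grlex_key])
qed

lemma mult_eq_sum_single:
  fixes p q :: "'a::comm_monoid_add \<Rightarrow>\<^sub>0 'k::comm_ring_1"
  shows "p * q = (\<Sum>a\<in>keys p. \<Sum>b\<in>keys q. single (a + b) (lookup p a * lookup q b))"
proof -
  have "p * q = (\<Sum>a\<in>keys p. single a (lookup p a)) * (\<Sum>b\<in>keys q. single b (lookup q b))"
    by (simp add: sum_single_keys)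
  also have "\<dots> = (\<Sum>a\<in>keys p. \<Sum>b\<in>keys q. single (a + b) (lookup p a * lookup q b))"
    by (simp add: sum_product mult_single)
  finally show ?thesis .
qed

text \<open>The order is compatible with addition, so a product of two terms reaches this exponent
  only if both terms are leading; no cancellation can occur there.\<close>

lemma lookup_mult_lead_exp:
  fixes p q :: "('v::finite, 'k::comm_ring_1) mpoly"
  assumes "p \<noteq> 0" "q \<noteq> 0"
  shows "lookup (p * q) (lead_exp p + lead_exp q) = lookup p (lead_exp p) * lookup q (lead_exp q)"
proof -
  let ?P = "lead_exp p" and ?Q = "lead_exp q"
  have eq: "a + b = ?P + ?Q \<longleftrightarrow> a = ?P \<and> b = ?Q" if "a \<in> keys p" "b \<in> keys q" for a b
  proof
    assume "a + b = ?P + ?Q"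
    then have s: "grlex_key a + grlex_key b = grlex_key ?P + grlex_key ?Q"
      by (simp flip: grlex_key_add)
    have "grlex_key a \<le> grlex_key ?P" "grlex_key b \<le> grlex_key ?Q"
      using that assms by (auto intro: lead_exp)
    with s have "grlex_key a = grlex_key ?P" "grlex_key b = grlex_key ?Q"
      by (metis add_less_le_mono order_le_imp_less_or_eq order_less_irrefl,
          metis add_le_less_mono order_le_imp_less_or_eq order_less_irrefl \<open>grlex_key a \<le> grlex_key ?P\<close>)
    then show "a = ?P \<and> b = ?Q" by (auto dest: injD[OF inj_grlex_key])
  qed auto
  have "lookup (p * q) (?P + ?Q) =
      (\<Sum>a\<in>keys p. \<Sum>b\<in>keys q. if a + b = ?P + ?Q then lookup p a * lookup q b else 0)"
    by (simp add: mult_eq_sum_single[of p q] lookup_sum lookup_single when_def)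
  also have "\<dots> = (\<Sum>a\<in>keys p. \<Sum>b\<in>keys q. if a = ?P \<and> b = ?Q then lookup p a * lookup q b else 0)"
    by (intro sum.cong) (auto simp: eq)
  also have "\<dots> = (\<Sum>a\<in>keys p. if a = ?P then (\<Sum>b\<in>keys q. if b = ?Q then lookup p a * lookup q b else 0) else 0)"
    by (intro sum.cong) auto
  also have "\<dots> = lookup p ?P * lookup q ?Q"
    using lead_exp[OF assms(1)] lead_exp[OF assms(2)] by simp
  finally show ?thesis .
qed

lemma mpoly_no_zero_divisors:
  fixes p q :: "('v::finite, 'k::idom) mpoly"
  assumes "p \<noteq> 0" "q \<noteq> 0"
  shows "p * q \<noteq> 0"
proof
  assume "p * q = 0"
  then have "lookup p (lead_exp p) * lookup q (lead_exp q) = 0"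
    using lookup_mult_lead_exp[OF assms] by simp
  then show False using lead_exp(1)[OF assms(1)] lead_exp(1)[OF assms(2)] by (auto simp: in_keys_iff)
qed

lemma lead_exp_mult:
  fixes p q :: "('v::finite, 'k::idom) mpoly"
  assumes "p \<noteq> 0" "q \<noteq> 0"
  shows "lead_exp (p * q) = lead_exp p + lead_exp q"
proof (rule lead_exp_eqI)
  show "lead_exp p + lead_exp q \<in> keys (p * q)"
    using lookup_mult_lead_exp[OF assms] lead_exp(1)[OF assms(1)] lead_exp(1)[OF assms(2)]
    by (auto simp: in_keys_iff)
next
  fix w assume "w \<in> keys (p * q)"
  then obtain a b where "w = a + b" "a \<in> keys p" "b \<in> keys q"
    using keys_mult[of p q] by blast
  then show "grlex_key w \<le> grlex_key (lead_exp p + lead_exp q)"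
    using lead_exp(2)[OF assms(1)] lead_exp(2)[OF assms(2)] by (simp add: grlex_key_add add_mono)
qed

lemma prime_ideal_toric_ideal:
  fixes ends :: "'e::finite \<Rightarrow> 'v::finite set"
  shows "prime_ideal (toric_ideal ends :: ('e, 'k::field) mpoly set)"
proof -
  have "toric_map ends (single 0 1 :: ('e, 'k) mpoly) \<noteq> 0"
    by (simp only: toric_map_single) simp
  then have "toric_ideal ends \<noteq> (UNIV :: ('e, 'k) mpoly set)"
    unfolding toric_ideal_def by blast
  then show ?thesis
    using is_ideal_toric_ideal mpoly_no_zero_divisors
    by (auto simp: prime_ideal_def toric_ideal_def toric_map_mult)
qed

subsection \<open>Upper bound for the height\<close>

definition lin_indep_mod :: "('e::finite, 'k::field) mpoly set \<Rightarrow> (nat \<Rightarrow> ('e, 'k) mpoly) \<Rightarrow> nat \<Rightarrow> bool" where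
  "lin_indep_mod P g M \<longleftrightarrow> (\<forall>c. (\<Sum>j<M. single 0 (c j) * g j) \<in> P \<longrightarrow> (\<forall>j<M. c j = 0))"

definition exp_bounded :: "nat \<Rightarrow> ('e, 'k::zero) mpoly \<Rightarrow> bool" where
  "exp_bounded d p \<longleftrightarrow> (\<forall>u\<in>keys p. \<forall>e. lookup u e \<le> d)"

text \<open>An elementary substitute for the quotient by \<open>P\<close> having dimension at least
  \<open>t\<close>. The constant \<open>d\<close> must not depend on \<open>N\<close>, so that the
  exponents grow only linearly.\<close>

definition poly_growth :: "('e::finite, 'k::field) mpoly set \<Rightarrow> nat \<Rightarrow> bool" where
  "poly_growth P t \<longleftrightarrow> (\<exists>d. \<forall>N. \<exists>g. (\<forall>j<N ^ t. exp_bounded (d * N) (g j)) \<and> lin_indep_mod P g (N ^ t))"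

lemma exp_bounded_mult:
  fixes p q :: "('e, 'k::comm_ring_1) mpoly"
  assumes "exp_bounded d p" "exp_bounded d' q"
  shows "exp_bounded (d + d') (p * q)"
  unfolding exp_bounded_def
proof clarify
  fix u e assume "u \<in> keys (p * q)"
  then obtain a b where "u = a + b" "a \<in> keys p" "b \<in> keys q" using keys_mult[of p q] by blast
  then show "lookup u e \<le> d + d'"
    using assms by (auto simp: exp_bounded_def lookup_add intro: add_mono)
qed

lemma exp_bounded_power:
  fixes p :: "('e, 'k::comm_ring_1) mpoly"
  assumes "exp_bounded d p"
  shows "exp_bounded (n * d) (p ^ n)"
proof (induction n)
  case 0
  show ?case by (simp add: exp_bounded_def)
next
  case (Suc n)
  then show ?case using exp_bounded_mult[OF assms Suc] by simp
qed

lemma exp_bounded_mono: "exp_bounded d p \<Longrightarrow> d \<le> d' \<Longrightarrow> exp_bounded d' p"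
  unfolding exp_bounded_def by (meson order_trans)

lemma exp_bounded_exists: "\<exists>d. exp_bounded d (p :: ('e::finite, 'k::zero) mpoly)"
proof -
  have "lookup u e \<le> Max ((\<lambda>(u, e). lookup u e) ` (keys p \<times> UNIV))" if "u \<in> keys p" for u e
    using that by (intro Max_ge) auto
  then show ?thesis unfolding exp_bounded_def by blast
qed

lemma is_ideal_diff: "is_ideal I \<Longrightarrow> a \<in> I \<Longrightarrow> b \<in> I \<Longrightarrow> a - b \<in> I"
  unfolding is_ideal_def by (metis mult_minus1 uminus_add_conv_diff add.commute)

text \<open>Modulo \<open>Q\<close> only the summand with \<open>i = 0\<close> survives, so its
  coefficients vanish by independence of \<open>g\<close>. What remains is a multiple of
  \<open>f\<close>; as \<open>P\<close> is prime and \<open>f \<notin> P\<close>, this factor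
  cancels and induction applies.\<close>

lemma power_combinations_coeffs_zero:
  assumes P: "prime_ideal P" and Q: "prime_ideal Q" and PQ: "P \<subseteq> Q"
    and f: "f \<in> Q" "f \<notin> P" and g: "lin_indep_mod Q g M"
    and "(\<Sum>i<n. (\<Sum>k<M. single 0 (c i k) * g k) * f ^ i) \<in> P"
  shows "\<forall>i<n. \<forall>k<M. c i k = 0"
  using assms(7)
proof (induction n arbitrary: c)
  case (Suc n)
  define s where "s = (\<Sum>i<n. (\<Sum>k<M. single 0 (c (Suc i) k) * g k) * f ^ i)"
  define r where "r = (\<Sum>k<M. single 0 (c 0 k) * g k)"
  have tot: "r + s * f \<in> P"
    using Suc.prems unfolding sum.lessThan_Suc_shift r_def s_def sum_distrib_right[of _ _ f]
    by (simp add: mult.assoc power_commutes)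
  have "is_ideal Q" using Q by (simp add: prime_ideal_def)
  then have "s * f \<in> Q" using f by (simp add: is_ideal_def)
  moreover have "r + s * f \<in> Q" using tot PQ by blast
  ultimately have "r \<in> Q" using is_ideal_diff[OF \<open>is_ideal Q\<close>] by fastforce
  then have c0: "\<forall>k<M. c 0 k = 0" using g by (simp add: lin_indep_mod_def r_def)
  then have "r = 0" by (simp add: r_def)
  with tot f P have "s \<in> P" by (auto simp: prime_ideal_def)
  from Suc.IH[OF this[unfolded s_def]] c0 show ?case
    by (metis less_Suc_eq_0_disj)
qed simp

text \<open>An element of \<open>Q\<close> outside \<open>P\<close> acts as a new variable: its
  powers, multiplied with a family independent modulo \<open>Q\<close>, give a larger family
  independent modulo \<open>P\<close>.\<close>

lemma poly_growth_Suc: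
  fixes P Q :: "('e::finite, 'k::field) mpoly set"
  assumes P: "prime_ideal P" and Q: "prime_ideal Q" and PQ: "P \<subset> Q" and gr: "poly_growth Q t"
  shows "poly_growth P (Suc t)"
proof -
  obtain f where f: "f \<in> Q" "f \<notin> P" using PQ by blast
  obtain b where b: "exp_bounded b f" using exp_bounded_exists by blast
  obtain d where d: "\<And>N. \<exists>g. (\<forall>j<N ^ t. exp_bounded (d * N) (g j)) \<and> lin_indep_mod Q g (N ^ t)"
    using gr unfolding poly_growth_def by blast
  have "\<exists>g. (\<forall>j<N ^ Suc t. exp_bounded ((d + b) * N) (g j)) \<and> lin_indep_mod P g (N ^ Suc t)" for N
  proof -
    define M where "M = N ^ t"
    from d[of N] obtain g where g: "\<And>j. j < M \<Longrightarrow> exp_bounded (d * N) (g j)" "lin_indep_mod Q g M"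
      unfolding M_def by blast
    \<comment> \<open>Writing \<open>j = i * M + k\<close> with \<open>k < M\<close> lets the single
      index \<open>j\<close> run over all products of \<open>g k\<close> with \<open>f ^ i\<close>,
      for \<open>i < N\<close>.\<close>
    define h where "h = (\<lambda>j. g (j mod M) * f ^ (j div M))"
    have "exp_bounded ((d + b) * N) (h j)" if "j < N * M" for j
    proof -
      have "M > 0" using that by (cases M) auto
      then have "j mod M < M" "j div M < N" using that by (auto simp: less_mult_imp_div_less)
      then have "exp_bounded (d * N + (j div M) * b) (h j)"
        unfolding h_def by (intro exp_bounded_mult g exp_bounded_power b)
      then show ?thesis
        by (rule exp_bounded_mono) (use \<open>j div M < N\<close> in \<open>simp add: algebra_simps\<close>)
    qed
    moreover have "lin_indep_mod P h (N * M)"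
      unfolding lin_indep_mod_def
    proof (intro allI impI)
      fix c j assume s: "(\<Sum>j<N * M. single 0 (c j) * h j) \<in> P" and j: "j < N * M"
      have M: "M > 0" using j by (cases M) auto
      have "(\<Sum>j<N * M. single 0 (c j) * h j) = (\<Sum>i<N. \<Sum>j=i * M..<i * M + M. single 0 (c j) * h j)"
        by (simp add: sum.nat_group)
      also have "\<dots> = (\<Sum>i<N. \<Sum>k<M. single 0 (c (i * M + k)) * h (i * M + k))"
        by (rule sum.cong[OF refl], subst sum.atLeastLessThan_shift_0) (simp add: atLeast0LessThan)
      also have "\<dots> = (\<Sum>i<N. (\<Sum>k<M. single 0 (c (i * M + k)) * g k) * f ^ i)"
        using M by (auto simp: h_def sum_distrib_right mult.assoc intro!: sum.cong)
      finally have "(\<Sum>i<N. (\<Sum>k<M. single 0 (c (i * M + k)) * g k) * f ^ i) \<in> P" using s by simp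
      from power_combinations_coeffs_zero[OF P Q psubset_imp_subset[OF PQ] f g(2) this]
      have "c (j div M * M + j mod M) = 0"
        using j M by (meson less_mult_imp_div_less mod_less_divisor)
      then show "c j = 0" by simp
    qed
    ultimately show ?thesis unfolding M_def by auto
  qed
  then show ?thesis unfolding poly_growth_def by blast
qed

text \<open>Counting monomials: their number within the exponent bound grows like a power of
  \<open>N\<close> with exponent \<open>CARD('e)\<close>, so for larger \<open>t\<close> the
  \<open>N ^ t\<close> polynomials become linearly dependent.\<close>

lemma poly_growth_le_card:
  fixes P :: "('e::finite, 'k::field) mpoly set"
  assumes "is_ideal P" "poly_growth P t"
  shows "t \<le> CARD('e)"
proof (rule ccontr)
  define m where "m = CARD('e)"
  assume "\<not> t \<le> CARD('e)"
  then have t: "Suc m \<le> t" by (simp add: m_def)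
  obtain d where d: "\<And>N. \<exists>g. (\<forall>j<N ^ t. exp_bounded (d * N) (g j)) \<and> lin_indep_mod P g (N ^ t)"
    using assms(2) unfolding poly_growth_def by blast
  \<comment> \<open>The number of monomials is at most \<open>(d + 1) ^ m * N ^ m\<close>, which
    this choice makes smaller than \<open>N ^ Suc m\<close>.\<close>
  define N where "N = (d + 1) ^ m + 1"
  define B where "B = {u :: 'e \<Rightarrow>\<^sub>0 nat. \<forall>e. lookup u e \<le> d * N}"
  have N: "N \<ge> 1" by (simp add: N_def)
  have "card B \<le> (d * N + 1) ^ m"
    unfolding B_def m_def by (rule card_bounded_exponents)
  also have "\<dots> \<le> ((d + 1) * N) ^ m"
    using N by (intro power_mono) (auto simp: distrib_right)
  also have "\<dots> = (d + 1) ^ m * N ^ m" by (rule power_mult_distrib)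
  also have "\<dots> < N * N ^ m" using N by (intro mult_strict_right_mono) (auto simp: N_def)
  also have "\<dots> \<le> N ^ t" using power_increasing[OF t N] by simp
  finally have less: "card B < N ^ t" .
  obtain g where g: "\<And>j. j < N ^ t \<Longrightarrow> exp_bounded (d * N) (g j)" "lin_indep_mod P g (N ^ t)"
    using d[of N] by blast
  have "finite B" unfolding B_def by (rule finite_bounded_exponents)
  from underdetermined_system_nontrivial[OF this, of "{..<N ^ t}" "\<lambda>u j. lookup (g j) u"] less
  obtain c where c: "\<exists>j<N ^ t. c j \<noteq> 0" "\<And>u. u \<in> B \<Longrightarrow> (\<Sum>j<N ^ t. lookup (g j) u * c j) = 0"
    by auto
  have "(\<Sum>j<N ^ t. single 0 (c j) * g j) = 0"
  proof (rule poly_mapping_eqI)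
    fix u
    have "lookup (\<Sum>j<N ^ t. single 0 (c j) * g j) u = (\<Sum>j<N ^ t. lookup (g j) u * c j)"
      by (simp add: lookup_sum lookup_scale) (simp add: mult.commute)
    also have "\<dots> = 0"
    proof (cases "u \<in> B")
      case False
      then have "lookup (g j) u = 0" if "j < N ^ t" for j
        using g(1)[OF that] unfolding B_def exp_bounded_def by (auto simp: in_keys_iff)
      then show ?thesis by simp
    qed (rule c)
    finally show "lookup (\<Sum>j<N ^ t. single 0 (c j) * g j) u = lookup 0 u" by simp
  qed
  then have "(\<Sum>j<N ^ t. single 0 (c j) * g j) \<in> P" using assms(1) by (simp add: is_ideal_def)
  then show False using g(2) c(1) unfolding lin_indep_mod_def by blast
qed

text \<open>Linear independence over the rationals of the incidence vectors of the edges in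
  \<open>T\<close>: an integer relation is split into its positive and negative parts.\<close>

definition indep_edges :: "('e \<Rightarrow> 'v set) \<Rightarrow> 'e set \<Rightarrow> bool" where
  "indep_edges ends T \<longleftrightarrow> (\<forall>u u'. keys u \<subseteq> T \<longrightarrow> keys u' \<subseteq> T \<longrightarrow>
      vertex_exp ends u = vertex_exp ends u' \<longrightarrow> u = u')"

text \<open>The monomials in \<open>T\<close> with exponents below \<open>N\<close> have pairwise
  different vertex degrees, so the toric map sends them to distinct monomials.\<close>

lemma poly_growth_toric_ideal:
  fixes ends :: "'e::finite \<Rightarrow> 'v::finite set"
  assumes "indep_edges ends T"
  shows "poly_growth (toric_ideal ends :: ('e, 'k::field) mpoly set) (card T)"
proof -
  have "\<exists>g :: nat \<Rightarrow> ('e, 'k) mpoly. (\<forall>j<N ^ card T. exp_bounded (1 * N) (g j)) \<and>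
      lin_indep_mod (toric_ideal ends) g (N ^ card T)" for N
  proof -
    define D where "D = {u :: 'e \<Rightarrow>\<^sub>0 nat. keys u \<subseteq> T \<and> (\<forall>e\<in>T. lookup u e < N)}"
    let ?F = "T \<rightarrow>\<^sub>E {..<N}"
    have "bij_betw (\<lambda>u. restrict (lookup u) T) D ?F"
    proof (rule bij_betwI')
      fix u u' assume "u \<in> D" "u' \<in> D"
      then have "lookup u e = lookup u' e" if "e \<notin> T" for e
        using that unfolding D_def by (metis (mono_tags, lifting) in_keys_iff mem_Collect_eq subsetD)
      then show "(restrict (lookup u) T = restrict (lookup u') T) = (u = u')"
        by (metis poly_mapping_eqI restrict_apply')
    next
      fix u assume "u \<in> D"
      then show "restrict (lookup u) T \<in> ?F" by (auto simp: D_def)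
    next
      fix f assume f: "f \<in> ?F"
      define u where "u = Abs_poly_mapping (\<lambda>e. if e \<in> T then f e else 0)"
      have u: "lookup u e = (if e \<in> T then f e else 0)" for e
        by (simp add: u_def)
      have "u \<in> D" using f by (auto simp: D_def u in_keys_iff split: if_splits)
      moreover have "f = restrict (lookup u) T"
        by (intro PiE_ext[OF f]) (use f in \<open>auto simp: u\<close>)
      ultimately show "\<exists>u\<in>D. f = restrict (lookup u) T" by blast
    qed
    then have cD: "card D = N ^ card T" and fD: "finite D"
      using bij_betw_same_card[of _ D ?F] bij_betw_finite[of _ D ?F]
      by (auto simp: card_PiE finite_PiE)
    obtain h where h: "bij_betw h {..<N ^ card T} D"
      using ex_bij_betw_nat_finite[OF fD] cD by (auto simp: atLeast0LessThan)
    define g :: "nat \<Rightarrow> ('e, 'k) mpoly" where "g = (\<lambda>j. single (h j) 1)"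
    have hD: "h j \<in> D" if "j < N ^ card T" for j
      using h that by (auto simp: bij_betw_def)
    have "exp_bounded (1 * N) (g j)" if "j < N ^ card T" for j
      unfolding exp_bounded_def
    proof clarify
      fix u e assume "u \<in> keys (g j)"
      then have "u = h j" by (auto simp: g_def split: if_splits)
      then show "lookup u e \<le> 1 * N"
        using hD[OF that] unfolding D_def mem_Collect_eq mult_1
        by (metis in_keys_iff le0 less_imp_le subsetD)
    qed
    moreover have "lin_indep_mod (toric_ideal ends) g (N ^ card T)"
      unfolding lin_indep_mod_def
    proof (intro allI impI)
      fix c i
      assume mem: "(\<Sum>j<N ^ card T. single 0 (c j) * g j) \<in> toric_ideal ends" and i: "i < N ^ card T"
      have eq: "vertex_exp ends (h j) = vertex_exp ends (h i) \<longleftrightarrow> j = i" if "j < N ^ card T" for j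
        using hD[OF that] hD[OF i] assms h that i
        unfolding indep_edges_def D_def bij_betw_def inj_on_def by auto
      \<comment> \<open>The indicator of one vertex degree is constant on fibers, so it vanishes on
        the toric ideal; here it extracts the coefficient \<open>c i\<close>.\<close>
      have "0 = lin_ext (\<lambda>a. (\<lambda>b. if b = vertex_exp ends (h i) then 1 else 0) (vertex_exp ends a))
          (\<Sum>j<N ^ card T. single 0 (c j) * g j)"
        using toric_ideal_lin_ext[OF mem] by (rule sym)
      also have "\<dots> = (\<Sum>j<N ^ card T. c j * (if vertex_exp ends (h j) = vertex_exp ends (h i) then 1 else 0))"
        by (simp add: lin_ext_sum g_def mult_single)
      also have "\<dots> = (\<Sum>j<N ^ card T. if j = i then c j else 0)"
        by (intro sum.cong) (auto simp: eq)
      also have "\<dots> = c i" using i by simp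
      finally show "c i = 0" by simp
    qed
    ultimately show ?thesis by blast
  qed
  then show ?thesis unfolding poly_growth_def by blast
qed

text \<open>Descending a chain of primes from the toric ideal raises the growth exponent from
  \<open>card T\<close> by one at each step, and it can never exceed the number of edges.\<close>

lemma ideal_height_toric_ideal_le:
  fixes ends :: "'e::finite \<Rightarrow> 'v::finite set"
  assumes "indep_edges ends T"
  shows "ideal_height (toric_ideal ends :: ('e, 'k::field) mpoly set) \<le> enat (CARD('e) - card T)"
proof -
  let ?I = "toric_ideal ends :: ('e, 'k) mpoly set"
  have "n \<le> CARD('e) - card T"
    if C: "\<forall>i\<le>n. prime_ideal (C i)" "\<forall>i<n. C i \<subset> C (Suc i)" "C n = ?I" for n and C :: "nat \<Rightarrow> ('e, 'k) mpoly set"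
  proof -
    have "poly_growth (C (n - i)) (card T + i)" if "i \<le> n" for i
      using that
    proof (induction i)
      case 0
      then show ?case using poly_growth_toric_ideal[OF assms, where ?'k = 'k] C(3) by simp
    next
      case (Suc i)
      then have "Suc (n - Suc i) = n - i" by simp
      then have "C (n - Suc i) \<subset> C (n - i)" using C(2) Suc.prems by (metis Suc_le_eq diff_less less_le_trans zero_less_Suc)
      with Suc show ?case
        using poly_growth_Suc[of "C (n - Suc i)" "C (n - i)" "card T + i"] C(1) by simp
    qed
    from this[of n] have "poly_growth (C 0) (card T + n)" by simp
    then have "card T + n \<le> CARD('e)"
      using poly_growth_le_card C(1) by (auto simp: prime_ideal_def)
    then show ?thesis by simp
  qed
  then have "prime_height ?I \<le> enat (CARD('e) - card T)"
    unfolding prime_height_def by (intro Sup_least) auto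
  moreover have "ideal_height ?I \<le> prime_height ?I"
    unfolding ideal_height_def using prime_ideal_toric_ideal by (intro Inf_lower) blast
  ultimately show ?thesis by (rule order_trans[rotated])
qed

subsection \<open>Fibers\<close>

definition linked :: "('e \<Rightarrow> 'v set) \<Rightarrow> ('e \<Rightarrow>\<^sub>0 nat) \<Rightarrow> ('e \<Rightarrow>\<^sub>0 nat) \<Rightarrow> bool" where
  "linked ends = (\<lambda>u u'. vertex_exp ends u = vertex_exp ends u' \<and> keys u \<inter> keys u' \<noteq> {})\<^sup>*\<^sup>*"

text \<open>The choice depends only on the predicate \<open>linked ends u\<close>, which is the same
  for linked monomials; so each class receives one representative.\<close>

definition class_rep :: "('e \<Rightarrow> 'v set) \<Rightarrow> ('e \<Rightarrow>\<^sub>0 nat) \<Rightarrow> ('e \<Rightarrow>\<^sub>0 nat)" where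
  "class_rep ends u = (SOME u'. linked ends u u')"

text \<open>Chosen through the degree alone, so that the whole fiber shares one root, and normalized
  to be a class representative.\<close>

definition fiber_root :: "('e \<Rightarrow> 'v set) \<Rightarrow> ('e \<Rightarrow>\<^sub>0 nat) \<Rightarrow> ('e \<Rightarrow>\<^sub>0 nat)" where
  "fiber_root ends u = class_rep ends (SOME u'. vertex_exp ends u' = vertex_exp ends u)"

text \<open>An element $z$ stands for the binomial $e^z - e^{r}$, where $r$ is the root of the fiber of $z$.\<close>
definition minimal_moves :: "('e \<Rightarrow> 'v set) \<Rightarrow> ('e \<Rightarrow>\<^sub>0 nat) set" where
  "minimal_moves ends = {z. class_rep ends z = z \<and> z \<noteq> fiber_root ends z}"

lemma linked_refl: "linked ends u u"
  by (simp add: linked_def)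

lemma linked_sym: "linked ends u u' \<Longrightarrow> linked ends u' u"
  unfolding linked_def by (rule sympD[OF symp_rtranclp]) (auto intro: sympI)

lemma linked_trans: "linked ends u u' \<Longrightarrow> linked ends u' u'' \<Longrightarrow> linked ends u u''"
  unfolding linked_def by (rule rtranclp_trans)

lemma linked_vertex_exp: "linked ends u u' \<Longrightarrow> vertex_exp ends u = vertex_exp ends u'"
  unfolding linked_def by (induction rule: rtranclp_induct) auto

lemma linked_class_rep: "linked ends u (class_rep ends u)"
  unfolding class_rep_def by (rule someI) (rule linked_refl)

lemma class_rep_eq: "linked ends u u' \<Longrightarrow> class_rep ends u = class_rep ends u'"
proof -
  assume "linked ends u u'"
  then have "linked ends u = linked ends u'"
    by (intro ext) (meson linked_sym linked_trans)
  then show ?thesis by (simp add: class_rep_def)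
qed

lemma class_rep_class_rep: "class_rep ends (class_rep ends u) = class_rep ends u"
  by (rule class_rep_eq[OF linked_class_rep, symmetric])

lemma vertex_exp_class_rep: "vertex_exp ends (class_rep ends u) = vertex_exp ends u"
  by (rule linked_vertex_exp[OF linked_class_rep, symmetric])

lemma fiber_root_eq: "vertex_exp ends u = vertex_exp ends u' \<Longrightarrow> fiber_root ends u = fiber_root ends u'"
  by (simp add: fiber_root_def)

lemma vertex_exp_fiber_root: "vertex_exp ends (fiber_root ends u) = vertex_exp ends u"
  unfolding fiber_root_def vertex_exp_class_rep by (rule someI) (rule refl)

lemma class_rep_fiber_root: "class_rep ends (fiber_root ends u) = fiber_root ends u"
  unfolding fiber_root_def by (rule class_rep_class_rep)

text \<open>A nonconstant common factor contains an edge that both products share. So multiplication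
  by it moves a whole fiber into a single class.\<close>

lemma linked_add:
  fixes ends :: "'e::finite \<Rightarrow> 'v::finite set"
  assumes "vertex_exp ends u = vertex_exp ends u'" "c \<noteq> 0"
  shows "linked ends (c + u) (c + u')"
proof -
  obtain e where "e \<in> keys c" using assms(2) keys_eq_empty by blast
  then have "e \<in> keys (c + u) \<inter> keys (c + u')" by (auto simp: in_keys_iff lookup_add)
  then show ?thesis
    using assms(1) unfolding linked_def by (intro r_into_rtranclp) (auto simp: vertex_exp_add)
qed

text \<open>A graded form of Nakayama's lemma. With fewer generators than moves, a nontrivial
  combination of class sums would vanish on all generators and then on the whole ideal, but the
  binomial of a move in \<open>Z\<close> reads off its coefficient.\<close>

lemma card_minimal_moves_subset_le:
  fixes ends :: "'e::finite \<Rightarrow> 'v::finite set" and gs :: "('e, 'k::field) mpoly list"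
  assumes gs: "toric_ideal ends = ideal_gen (set gs)"
    and Z: "finite Z" "Z \<subseteq> minimal_moves ends"
  shows "card Z \<le> length gs"
proof (rule ccontr)
  assume "\<not> card Z \<le> length gs"
  then have "card (set gs) < card Z" using card_length[of gs] by linarith
  from underdetermined_system_nontrivial[OF _ Z(1) this, of "\<lambda>g z. lin_ext (\<lambda>u. if linked ends u z then 1 else 0) g"]
  obtain c where c: "\<exists>z\<in>Z. c z \<noteq> 0"
    "\<And>g. g \<in> set gs \<Longrightarrow> (\<Sum>z\<in>Z. lin_ext (\<lambda>u. if linked ends u z then 1 else 0) g * c z) = 0"
    by auto
  \<comment> \<open>The combination of class sums as a function on exponents: it is
    \<open>c z\<close> on the class of \<open>z\<close>, and zero on classes that contain no element
    of \<open>Z\<close>.\<close>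
  define w where "w = (\<lambda>u. \<Sum>z\<in>Z. (if linked ends u z then 1 else 0) * c z)"
  have lin_w: "lin_ext w p = (\<Sum>z\<in>Z. lin_ext (\<lambda>u. if linked ends u z then 1 else 0) p * c z)" for p
    by (induction p rule: poly_mapping_add_induct)
       (auto simp: lin_ext_add w_def sum.distrib algebra_simps sum_distrib_left)
  have w_linked: "w u = w u'" if "linked ends u u'" for u u'
  proof -
    have "linked ends u z = linked ends u' z" for z
      using that by (meson linked_sym linked_trans)
    then show ?thesis by (simp add: w_def)
  qed
  define J where "J = {f \<in> toric_ideal ends. lin_ext w f = 0}"
  \<comment> \<open>A constant factor only rescales. A nonconstant monomial factor makes the shifted
    form constant on fibers, by \<open>linked_add\<close>, so that it vanishes on
    \<open>f\<close>.\<close>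
  have mult: "lin_ext w (r * f) = 0" if "f \<in> toric_ideal ends" "lin_ext w f = 0" for r f
  proof (induction r rule: poly_mapping_add_induct)
    case (single a k)
    show ?case
    proof (cases "a = 0")
      case True
      then show ?thesis using that by (simp add: lin_ext_single_mult)
    next
      case False
      define h where "h = (\<lambda>b. w (a + (SOME u. vertex_exp ends u = b)))"
      have "w (a + u) = h (vertex_exp ends u)" for u
        unfolding h_def by (rule w_linked, rule linked_add[OF _ False], rule someI2[of _ u]) auto
      then have "lin_ext (\<lambda>u. w (a + u)) f = lin_ext (\<lambda>u. h (vertex_exp ends u)) f" by simp
      then show ?thesis using toric_ideal_lin_ext[OF that(1)] by (simp add: lin_ext_single_mult)
    qed
  qed (simp add: distrib_right lin_ext_add)
  have "is_ideal (toric_ideal ends :: ('e, 'k) mpoly set)" by (rule is_ideal_toric_ideal)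
  then have "is_ideal J"
    unfolding is_ideal_def J_def by (auto simp: lin_ext_add mult)
  moreover have "set gs \<subseteq> J"
  proof
    fix g assume "g \<in> set gs"
    moreover from this have "g \<in> toric_ideal ends" unfolding gs ideal_gen_def by blast
    ultimately show "g \<in> J" using c(2) by (simp add: J_def lin_w)
  qed
  ultimately have sub: "toric_ideal ends \<subseteq> J" unfolding gs by (rule ideal_gen_subset)
  have "c z0 = 0" if z0: "z0 \<in> Z" for z0
  proof -
    let ?r = "fiber_root ends z0"
    have rep: "class_rep ends z = z" "z \<noteq> fiber_root ends z" if "z \<in> Z" for z
      using that Z(2) by (auto simp: minimal_moves_def)
    have "single z0 1 - single ?r 1 \<in> J"
      using sub binomial_in_toric_ideal[of ends z0 ?r] by (auto simp: vertex_exp_fiber_root)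
    then have "w z0 = w ?r" by (simp add: J_def lin_ext_diff)
    moreover have "w z0 = (\<Sum>z\<in>Z. if z = z0 then c z else 0)"
      unfolding w_def
      by (intro sum.cong) (auto simp: linked_refl, metis class_rep_eq rep(1) z0)
    \<comment> \<open>The class of the root contributes nothing: an element of \<open>Z\<close> in
      it would equal the root of its own fiber, which \<open>minimal_moves\<close> excludes.\<close>
    moreover have "w ?r = 0"
      unfolding w_def
    proof (intro sum.neutral ballI)
      fix z assume z: "z \<in> Z"
      have "\<not> linked ends ?r z"
      proof
        assume l: "linked ends ?r z"
        have "?r = z" using class_rep_eq[OF l] class_rep_fiber_root[of ends z0] rep(1)[OF z] by simp
        moreover have "fiber_root ends z = ?r"
          using linked_vertex_exp[OF l] by (intro fiber_root_eq) (simp add: vertex_exp_fiber_root)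
        ultimately show False using rep(2)[OF z] by simp
      qed
      then show "(if linked ends ?r z then 1 else 0) * c z = 0" by simp
    qed
    ultimately show "c z0 = 0" using z0 Z(1) by simp
  qed
  then show False using c(1) by blast
qed

lemma minimal_moves_finite_card:
  fixes ends :: "'e::finite \<Rightarrow> 'v::finite set" and gs :: "('e, 'k::field) mpoly list"
  assumes gs: "toric_ideal ends = ideal_gen (set gs)"
  shows "finite (minimal_moves ends)" "card (minimal_moves ends) \<le> length gs"
proof -
  show "finite (minimal_moves ends)"
  proof (rule ccontr)
    assume "infinite (minimal_moves ends)"
    then obtain Z where "Z \<subseteq> minimal_moves ends" "finite Z" "card Z = Suc (length gs)"
      using infinite_arbitrarily_large by blast
    then show False using card_minimal_moves_subset_le[OF gs, of Z] by simp
  qed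
  then show "card (minimal_moves ends) \<le> length gs"
    by (rule card_minimal_moves_subset_le[OF gs]) simp
qed

section \<open>Edge weights as functionals on the kernel lattice\<close>

definition edge_weight :: "('e::finite \<Rightarrow> real) \<Rightarrow> ('e \<Rightarrow>\<^sub>0 nat) \<Rightarrow> real" where
  "edge_weight \<phi> u = (\<Sum>e\<in>UNIV. \<phi> e * real (lookup u e))"

lemma edge_weight_add: "edge_weight \<phi> (u + w) = edge_weight \<phi> u + edge_weight \<phi> w"
  by (simp add: edge_weight_def lookup_add algebra_simps sum.distrib)

lemma edge_weight_single: "edge_weight \<phi> (single e n) = \<phi> e * real n"
proof -
  have "edge_weight \<phi> (single e n) = (\<Sum>e'\<in>UNIV. if e' = e then \<phi> e * real n else 0)"
    unfolding edge_weight_def by (intro sum.cong) (auto simp: lookup_single when_def)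
  then show ?thesis by simp
qed

text \<open>The moves generate the kernel lattice, and in degrees with a property \<open>D\<close>
  inherited by summands the moves of such degrees suffice. Induction on the total degree: common
  edges cancel, chains join the monomials of a class, and moves join each class to the root.\<close>

lemma edge_weight_constant_on_fibers:
  fixes ends :: "'e::finite \<Rightarrow> 'v::finite set"
  assumes ne: "\<And>e. ends e \<noteq> {}"
    and down: "\<And>b b'. D (b + b') \<Longrightarrow> D b"
    and moves: "\<And>z. z \<in> minimal_moves ends \<Longrightarrow> D (vertex_exp ends z) \<Longrightarrow>
        edge_weight \<phi> z = edge_weight \<phi> (fiber_root ends z)"
    and "vertex_exp ends u = vertex_exp ends u'" "D (vertex_exp ends u)"
  shows "edge_weight \<phi> u = edge_weight \<phi> u'"
  using assms(4,5)
proof (induction "\<Sum>v\<in>UNIV. lookup (vertex_exp ends u) v" arbitrary: u u' rule: less_induct)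
  case less
  have share: "edge_weight \<phi> w = edge_weight \<phi> w'"
    if eq: "vertex_exp ends w = vertex_exp ends w'" "keys w \<inter> keys w' \<noteq> {}"
      and w: "vertex_exp ends w = vertex_exp ends u" for w w'
  proof -
    obtain e where e: "e \<in> keys w" "e \<in> keys w'" using eq by blast
    have split: "w = single e 1 + (w - single e 1)" "w' = single e 1 + (w' - single e 1)"
      using e by (auto intro!: poly_mapping_eqI simp: lookup_add lookup_minus lookup_single when_def in_keys_iff)
    define a where "a = w - single e 1"
    define a' where "a' = w' - single e 1"
    have wa: "w = single e 1 + a" "w' = single e 1 + a'"
      using split by (simp_all add: a_def a'_def)
    have va: "vertex_exp ends a = vertex_exp ends a'"
      using eq(1) by (simp add: wa vertex_exp_add)
    have vu: "vertex_exp ends u = vertex_exp ends a + vertex_exp ends (single e 1)"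
      by (simp flip: w add: wa vertex_exp_add add.commute)
    obtain v where v: "v \<in> ends e" using ne by blast
    have "(\<Sum>v\<in>UNIV. lookup (vertex_exp ends (single e 1)) v) > 0"
      using v by (intro sum_pos2[of _ v]) (auto simp: lookup_vertex_exp lookup_single when_def)
    then have "(\<Sum>v\<in>UNIV. lookup (vertex_exp ends a) v) < (\<Sum>v\<in>UNIV. lookup (vertex_exp ends u) v)"
      by (simp add: vu lookup_add sum.distrib)
    moreover have "D (vertex_exp ends a)" using less.prems(2) unfolding vu by (rule down)
    ultimately have "edge_weight \<phi> a = edge_weight \<phi> a'" using less.hyps va by blast
    then show ?thesis by (simp add: wa edge_weight_add)
  qed
  have linked_weight: "edge_weight \<phi> w = edge_weight \<phi> w'"
    if "linked ends w w'" "vertex_exp ends w = vertex_exp ends u" for w w'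
    using that unfolding linked_def
  proof (induction rule: rtranclp_induct)
    case (step y z)
    have "vertex_exp ends w = vertex_exp ends y"
      using step.hyps(1) by (intro linked_vertex_exp) (simp add: linked_def)
    then show ?case using step share[of y z] by simp
  qed simp
  have root: "edge_weight \<phi> w = edge_weight \<phi> (fiber_root ends w)" if w: "vertex_exp ends w = vertex_exp ends u" for w
  proof -
    let ?z = "class_rep ends w"
    have r: "fiber_root ends ?z = fiber_root ends w"
      by (intro fiber_root_eq vertex_exp_class_rep)
    have "edge_weight \<phi> w = edge_weight \<phi> ?z"
      using linked_class_rep w by (rule linked_weight)
    also have "\<dots> = edge_weight \<phi> (fiber_root ends w)"
    proof (cases "?z = fiber_root ends w")
      case False
      then have "?z \<in> minimal_moves ends"
        by (simp add: minimal_moves_def class_rep_class_rep r)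
      then show ?thesis using moves[of ?z] less.prems w by (simp add: r vertex_exp_class_rep)
    qed simp
    finally show ?thesis .
  qed
  show ?case using root[of u] root[of u'] less.prems fiber_root_eq[of ends u u'] by simp
qed

text \<open>Exchanging the sums over edges and vertices shows that a weight induced by a vertex
  potential depends on the degree alone. Constraining only edges in the support of \<open>u\<close>
  permits a potential known on a part of the graph.\<close>

lemma edge_weight_pullback:
  fixes ends :: "'e::finite \<Rightarrow> 'v::finite set"
  assumes "\<And>e. e \<in> keys u \<Longrightarrow> \<phi> e = (\<Sum>v\<in>ends e. \<psi> v)"
  shows "edge_weight \<phi> u = (\<Sum>v\<in>UNIV. \<psi> v * real (lookup (vertex_exp ends u) v))"
proof -
  have "edge_weight \<phi> u = (\<Sum>e\<in>UNIV. \<Sum>v\<in>UNIV. if v \<in> ends e then \<psi> v * real (lookup u e) else 0)"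
    unfolding edge_weight_def
  proof (intro sum.cong refl)
    fix e
    show "\<phi> e * real (lookup u e) = (\<Sum>v\<in>UNIV. if v \<in> ends e then \<psi> v * real (lookup u e) else 0)"
      using assms[of e] by (cases "e \<in> keys u")
        (auto simp: in_keys_iff sum_distrib_right simp flip: sum.inter_restrict sum.inter_filter)
  qed
  also have "\<dots> = (\<Sum>v\<in>UNIV. \<Sum>e\<in>UNIV. if v \<in> ends e then \<psi> v * real (lookup u e) else 0)"
    by (rule sum.swap)
  also have "\<dots> = (\<Sum>v\<in>UNIV. \<psi> v * real (lookup (vertex_exp ends u) v))"
    by (intro sum.cong refl) (simp add: lookup_vertex_exp sum_distrib_left flip: sum.inter_filter)
  finally show ?thesis .
qed

text \<open>A column basis of the incidence matrix: by maximality every other edge takes part in a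
  relation that otherwise involves \<open>T\<close> only.\<close>

lemma maximal_indep_edges:
  fixes ends :: "'e::finite \<Rightarrow> 'v::finite set"
  obtains T where "indep_edges ends T"
    "\<And>e. e \<notin> T \<Longrightarrow> \<exists>u u'. keys u \<subseteq> insert e T \<and> keys u' \<subseteq> insert e T \<and>
        vertex_exp ends u = vertex_exp ends u' \<and> lookup u e \<noteq> lookup u' e"
proof -
  have "finite {T. indep_edges ends T}" by simp
  moreover have "indep_edges ends {}" by (auto simp: indep_edges_def)
  then have "{T. indep_edges ends T} \<noteq> {}" by blast
  ultimately obtain T where T: "indep_edges ends T" and mx: "\<And>T'. indep_edges ends T' \<Longrightarrow> T \<subseteq> T' \<Longrightarrow> T' = T"
    using finite_has_maximal[of "{T. indep_edges ends T}"] by auto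
  show thesis
  proof (rule that[OF T])
    fix e assume e: "e \<notin> T"
    then have "\<not> indep_edges ends (insert e T)" using mx[of "insert e T"] by blast
    then obtain u u' where u: "keys u \<subseteq> insert e T" "keys u' \<subseteq> insert e T"
      "vertex_exp ends u = vertex_exp ends u'" "u \<noteq> u'" unfolding indep_edges_def by blast
    \<comment> \<open>With equal exponents at \<open>e\<close> this power could be cancelled,
      leaving a nontrivial relation inside \<open>T\<close>.\<close>
    have "lookup u e \<noteq> lookup u' e"
    proof
      assume eq: "lookup u e = lookup u' e"
      define s where "s = single e (lookup u e)"
      have split: "u = s + (u - s)" "u' = s + (u' - s)"
        using eq by (auto intro!: poly_mapping_eqI simp: s_def lookup_add lookup_minus lookup_single when_def)
      have "vertex_exp ends s + vertex_exp ends (u - s) = vertex_exp ends s + vertex_exp ends (u' - s)"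
        using u(3) split by (metis vertex_exp_add)
      then have "vertex_exp ends (u - s) = vertex_exp ends (u' - s)" by simp
      moreover have "keys (u - s) \<subseteq> T" "keys (u' - s) \<subseteq> T"
        using u(1,2) eq by (auto simp: s_def subset_iff in_keys_iff lookup_minus lookup_single when_def split: if_splits)
      ultimately have "u - s = u' - s" using T unfolding indep_edges_def by blast
      then show False using split u(4) by metis
    qed
    then show "\<exists>u u'. keys u \<subseteq> insert e T \<and> keys u' \<subseteq> insert e T \<and>
        vertex_exp ends u = vertex_exp ends u' \<and> lookup u e \<noteq> lookup u' e"
      using u by blast
  qed
qed

text \<open>No move is redundant. There are at most \<open>card (- T)\<close> moves, so without
  \<open>z\<close> the moves with property \<open>D\<close> impose fewer conditions than there are
  edges outside \<open>T\<close>, and a nonzero weight supported there annihilates them. By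
  \<open>ext\<close> it is constant on all fibers, which a relation through an edge outside
  \<open>T\<close> refutes.\<close>

lemma complete_intersection_minimal_moves:
  fixes ends :: "'e::finite \<Rightarrow> 'v::finite set"
  assumes ci: "complete_intersection ends TYPE('k::field)"
    and ne: "\<And>e. ends e \<noteq> {}"
    and down: "\<And>b b'. D (b + b') \<Longrightarrow> D b"
    and ext: "\<And>\<phi> u u'. (\<And>u u'. vertex_exp ends u = vertex_exp ends u' \<Longrightarrow> D (vertex_exp ends u) \<Longrightarrow>
          edge_weight \<phi> u = edge_weight \<phi> u') \<Longrightarrow> vertex_exp ends u = vertex_exp ends u' \<Longrightarrow>
          edge_weight \<phi> u = edge_weight \<phi> u'"
    and z: "z \<in> minimal_moves ends"
  shows "D (vertex_exp ends z)"
proof (rule ccontr)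
  assume nD: "\<not> D (vertex_exp ends z)"
  obtain gs :: "('e, 'k) mpoly list" where gs: "enat (length gs) = ideal_height (toric_ideal ends :: ('e, 'k) mpoly set)"
    "toric_ideal ends = ideal_gen (set gs)"
    using ci unfolding complete_intersection_def by blast
  obtain T where T: "indep_edges ends T"
    and mx: "\<And>e. e \<notin> T \<Longrightarrow> \<exists>u u'. keys u \<subseteq> insert e T \<and> keys u' \<subseteq> insert e T \<and>
        vertex_exp ends u = vertex_exp ends u' \<and> lookup u e \<noteq> lookup u' e"
    using maximal_indep_edges[of ends] by metis
  define Z where "Z = {z \<in> minimal_moves ends. D (vertex_exp ends z)}"
  have "card Z < card (minimal_moves ends)"
    using z nD by (intro psubset_card_mono minimal_moves_finite_card(1)[OF gs(2)]) (auto simp: Z_def)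
  also have "\<dots> \<le> length gs" by (rule minimal_moves_finite_card(2)[OF gs(2)])
  also have "\<dots> \<le> CARD('e) - card T"
    using ideal_height_toric_ideal_le[OF T, where ?'k = 'k] by (simp flip: gs(1))
  also have "\<dots> = card (- T)" by (simp add: card_Diff_subset Compl_eq_Diff_UNIV)
  finally have less: "card Z < card (- T)" .
  have "finite Z" using minimal_moves_finite_card(1)[OF gs(2)] by (simp add: Z_def)
  from underdetermined_system_nontrivial[OF this _ less,
      of "\<lambda>z e. real (lookup z e) - real (lookup (fiber_root ends z) e)"]
  obtain c where c: "\<exists>e\<in>- T. c e \<noteq> 0"
    "\<And>z. z \<in> Z \<Longrightarrow> (\<Sum>e\<in>- T. (real (lookup z e) - real (lookup (fiber_root ends z) e)) * c e) = 0"
    by auto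
  define \<phi> where "\<phi> = (\<lambda>e. if e \<in> T then 0 else c e)"
  have wt: "edge_weight \<phi> u = (\<Sum>e\<in>- T. real (lookup u e) * c e)" for u
    unfolding edge_weight_def \<phi>_def by (intro sum.mono_neutral_cong_right) auto
  have moves: "edge_weight \<phi> z = edge_weight \<phi> (fiber_root ends z)"
    if "z \<in> minimal_moves ends" "D (vertex_exp ends z)" for z
    using c(2)[of z] that by (simp add: Z_def wt left_diff_distrib sum_subtractf)
  have const: "edge_weight \<phi> u = edge_weight \<phi> u'"
    if eq: "vertex_exp ends u = vertex_exp ends u'" for u u'
    by (rule ext[OF _ eq], rule edge_weight_constant_on_fibers[of ends D \<phi>, OF ne down moves])
  obtain e where e: "e \<notin> T" "c e \<noteq> 0" using c(1) by auto
  obtain u u' where u: "keys u \<subseteq> insert e T" "keys u' \<subseteq> insert e T"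
    "vertex_exp ends u = vertex_exp ends u'" "lookup u e \<noteq> lookup u' e"
    using mx[OF e(1)] by blast
  have "edge_weight \<phi> w = real (lookup w e) * c e" if "keys w \<subseteq> insert e T" for w
  proof -
    have "edge_weight \<phi> w = (\<Sum>e'\<in>- T. if e' = e then real (lookup w e) * c e else 0)"
      unfolding wt using that by (intro sum.cong) (auto simp: in_keys_iff)
    then show ?thesis using e by simp
  qed
  then show False using const[OF u(3)] u e by simp
qed

subsection \<open>The edge semigroup\<close>

abbreviation unit_exp :: "'v \<Rightarrow> ('v \<Rightarrow>\<^sub>0 nat)" where
  "unit_exp v \<equiv> single v 1"

definition edge_semigroup :: "('e \<Rightarrow> 'v set) \<Rightarrow> ('v \<Rightarrow>\<^sub>0 nat) set" where
  "edge_semigroup ends = range (vertex_exp ends)"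

definition list_exp :: "'v list \<Rightarrow> ('v \<Rightarrow>\<^sub>0 nat)" where
  "list_exp c = (\<Sum>v\<leftarrow>c. unit_exp v)"

lemma list_exp_simps [simp]:
  "list_exp [] = 0" "list_exp (v # c) = unit_exp v + list_exp c"
  "list_exp (c @ d) = list_exp c + list_exp d"
  by (simp_all add: list_exp_def)

lemma keys_list_exp: "keys (list_exp c) = set c"
proof (induction c)
  case (Cons v c)
  then show ?case by (auto simp: in_keys_iff lookup_add lookup_single when_def set_eq_iff)
qed simp

lemma list_exp_mset: "mset c = mset d \<Longrightarrow> list_exp c = list_exp d"
  unfolding list_exp_def by (metis mset_map sum_mset_sum_list)

lemma adj_sym: "adj ends u w \<Longrightarrow> adj ends w u"
  by (auto simp: adj_def insert_commute)

lemma edge_vertex_exp: "ends e = {u, w} \<Longrightarrow> u \<noteq> w \<Longrightarrow> vertex_exp ends (single e 1) = unit_exp u + unit_exp w"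
  by (simp add: vertex_exp_single)

lemma simple_graph_edgeE:
  assumes "simple_graph ends"
  obtains u w where "ends e = {u, w}" "u \<noteq> w"
  using assms card_2_iff[of "ends e"] unfolding simple_graph_def by metis

lemma keys_vertex_exp:
  fixes ends :: "'e::finite \<Rightarrow> 'v::finite set"
  assumes "e \<in> keys u"
  shows "ends e \<subseteq> keys (vertex_exp ends u)"
proof
  fix v assume "v \<in> ends e"
  then have "lookup u e \<le> lookup (vertex_exp ends u) v"
    unfolding lookup_vertex_exp by (intro member_le_sum) auto
  then show "v \<in> keys (vertex_exp ends u)" using assms by (auto simp: in_keys_iff)
qed

lemma zero_in_edge_semigroup: "0 \<in> edge_semigroup ends"
  unfolding edge_semigroup_def by (metis rangeI vertex_exp_0)

lemma add_in_edge_semigroup: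
  fixes ends :: "'e::finite \<Rightarrow> 'v::finite set"
  shows "a \<in> edge_semigroup ends \<Longrightarrow> b \<in> edge_semigroup ends \<Longrightarrow> a + b \<in> edge_semigroup ends"
  unfolding edge_semigroup_def by (auto simp flip: vertex_exp_add)

lemma edge_in_edge_semigroup: "adj ends u w \<Longrightarrow> unit_exp u + unit_exp w \<in> edge_semigroup ends"
  unfolding adj_def edge_semigroup_def using edge_vertex_exp by (metis rangeI)

text \<open>Every second edge of the walk covers each list position exactly once.\<close>

lemma even_walk_in_edge_semigroup:
  fixes ends :: "'e::finite \<Rightarrow> 'v::finite set"
  assumes "successively (adj ends) c" "even (length c)"
  shows "list_exp c \<in> edge_semigroup ends"
  using assms
proof (induction c rule: induct_list012)
  case (3 x y c)
  have "successively (adj ends) c"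
    using 3 by (cases c) auto
  then have "list_exp c \<in> edge_semigroup ends" using 3 by simp
  moreover have "unit_exp x + unit_exp y \<in> edge_semigroup ends"
    using 3 by (intro edge_in_edge_semigroup) simp
  ultimately have "(unit_exp x + unit_exp y) + list_exp c \<in> edge_semigroup ends"
    by (rule add_in_edge_semigroup[rotated])
  then show ?case by (simp add: add.assoc)
qed (auto simp: zero_in_edge_semigroup)

text \<open>The starting vertex is not repeated at the end, so \<open>length c\<close> counts the
  edges. Vertices may recur, and traversing one edge to and fro is a closed walk of length
  two.\<close>

definition closed_walk :: "('e \<Rightarrow> 'v set) \<Rightarrow> 'v list \<Rightarrow> bool" where
  "closed_walk ends c \<longleftrightarrow> c \<noteq> [] \<and> successively (adj ends) (c @ [hd c])"

lemma closed_walk_append: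
  assumes "xs \<noteq> []" "ys \<noteq> []"
  shows "closed_walk ends (xs @ ys) \<longleftrightarrow> successively (adj ends) (xs @ [hd ys]) \<and> successively (adj ends) (ys @ [hd xs])"
  using assms unfolding closed_walk_def
  by (auto simp: successively_append_iff[of _ xs] hd_append)

lemma closed_walk_rotate:
  assumes "closed_walk ends c" "a \<in> set c"
  obtains as where "closed_walk ends (a # as)" "mset (a # as) = mset c"
proof -
  obtain xs ys where c: "c = xs @ a # ys" using assms(2) split_list by metis
  show thesis
  proof (rule that[of "ys @ xs"])
    show "mset (a # ys @ xs) = mset c" by (simp add: c)
    show "closed_walk ends (a # ys @ xs)"
    proof (cases "xs = []")
      case True
      then show ?thesis using assms(1) c by simp
    next
      case False
      then show ?thesis
        using assms(1) closed_walk_append[of xs "a # ys" ends] closed_walk_append[of "a # ys" xs ends]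
        by (simp add: c)
    qed
  qed
qed

text \<open>Omitting the base point leaves an even walk, and returning to it at the end makes an
  even walk too. This realizes twice the vertex \<open>a\<close> as a difference of two elements of
  the edge semigroup.\<close>

lemma closed_walk_tl_in_edge_semigroup:
  fixes ends :: "'e::finite \<Rightarrow> 'v::finite set"
  assumes "closed_walk ends (a # as)" "odd (length (a # as))"
  shows "list_exp as \<in> edge_semigroup ends" "list_exp as + unit_exp a + unit_exp a \<in> edge_semigroup ends"
proof -
  have s: "successively (adj ends) (a # as @ [a])" using assms by (simp add: closed_walk_def)
  then have "successively (adj ends) as"
    using successively_append_iff[of "adj ends" "a # as" "[a]"] by (cases as) auto
  then show "list_exp as \<in> edge_semigroup ends"
    using assms by (intro even_walk_in_edge_semigroup) auto
  have "list_exp (a # as @ [a]) \<in> edge_semigroup ends"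
    using s assms by (intro even_walk_in_edge_semigroup) auto
  then show "list_exp as + unit_exp a + unit_exp a \<in> edge_semigroup ends"
    by (simp add: ac_simps)
qed

lemma is_cycle_closed_walk:
  assumes "is_cycle ends c"
  shows "closed_walk ends c"
proof -
  have c: "length c \<ge> 3" "\<And>i. i < length c \<Longrightarrow> adj ends (c ! i) (c ! ((i + 1) mod length c))"
    using assms by (auto simp: is_cycle_def)
  have "adj ends ((c @ [hd c]) ! i) ((c @ [hd c]) ! Suc i)" if "Suc i < length (c @ [hd c])" for i
  proof (cases "Suc i < length c")
    case True
    then show ?thesis using c(2)[of i] by (simp add: nth_append One_nat_def)
  next
    case False
    then have "Suc i = length c" using that by simp
    moreover have "c \<noteq> []" using c(1) by auto
    ultimately show ?thesis using c(2)[of i] by (simp add: nth_append hd_conv_nth One_nat_def)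
  qed
  then show ?thesis using c(1) by (auto simp: closed_walk_def successively_conv_nth)
qed

subsection \<open>The odd cycle condition\<close>

text \<open>The weight comes from a vertex potential. Away from \<open>x\<close> the potential at
  \<open>v\<close> is half the weight of a representation of \<open>2 v\<close> in
  \<open>G - x\<close>; these exist because \<open>G - x\<close> is connected and the hypothesis
  \<open>odd\<close> provides one for \<open>b0\<close>. Fibers of degree one at \<open>x\<close>
  then make the edges at \<open>x\<close> consistent.\<close>

lemma edge_weight_extends:
  fixes ends :: "'e::finite \<Rightarrow> 'v::finite set"
  assumes sg: "simple_graph ends"
    and conn: "\<And>v. v \<noteq> x \<Longrightarrow> reach_in ends (UNIV - {x}) b0 v" and b0: "b0 \<noteq> x"
    and odd: "vertex_exp ends w0 + unit_exp b0 + unit_exp b0 = vertex_exp ends w0'" "lookup (vertex_exp ends w0) x = 0"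
    and const: "\<And>u u'. vertex_exp ends u = vertex_exp ends u' \<Longrightarrow> lookup (vertex_exp ends u) x \<le> 1 \<Longrightarrow>
        edge_weight \<phi> u = edge_weight \<phi> u'"
    and eq: "vertex_exp ends u = vertex_exp ends u'"
  shows "edge_weight \<phi> u = edge_weight \<phi> u'"
proof -
  let ?A = "vertex_exp ends"
  define P where "P v \<longleftrightarrow> (\<exists>w w'. ?A w + unit_exp v = ?A w' + unit_exp b0 \<and> lookup (?A w) x = 0)" for v
  define Q where "Q v \<longleftrightarrow> (\<exists>w w'. ?A w + unit_exp v + unit_exp b0 = ?A w' \<and> lookup (?A w) x = 0)" for v
  \<comment> \<open>Each edge of $G - x$ exchanges $P$ and $Q$, and the odd cycle through $b_0$ gives $Q(b_0)$.\<close>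
  have PQ: "P v \<and> Q v" if "v \<noteq> x" for v
    using conn[OF that] unfolding reach_in_def
  proof (induction rule: rtranclp_induct)
    case base
    have "P b0" unfolding P_def by (rule exI[of _ 0], rule exI[of _ 0]) simp
    moreover have "Q b0" unfolding Q_def using odd by blast
    ultimately show ?case by simp
  next
    case (step v v')
    then have v: "v \<noteq> x" "v' \<noteq> x" "adj ends v v'" by auto
    then obtain e where e: "?A (single e 1) = unit_exp v + unit_exp v'"
      unfolding adj_def using edge_vertex_exp by metis
    obtain w w' where w: "?A w + unit_exp v = ?A w' + unit_exp b0" "lookup (?A w) x = 0"
      using step.IH unfolding P_def by blast
    have "lookup (?A w') x = 0"
      using arg_cong[OF w(1), of "\<lambda>p. lookup p x"] w(2) v b0 by (simp add: lookup_add lookup_single when_def)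
    moreover have "?A w' + unit_exp v' + unit_exp b0 = (?A w' + unit_exp b0) + unit_exp v'"
      by (simp add: ac_simps)
    then have "?A w' + unit_exp v' + unit_exp b0 = ?A (w + single e 1)"
      by (simp only: w(1)[symmetric] vertex_exp_add e add.assoc)
    ultimately have Q: "Q v'" unfolding Q_def by blast
    obtain w w' where w: "?A w + unit_exp v + unit_exp b0 = ?A w'" "lookup (?A w) x = 0"
      using step.IH unfolding Q_def by blast
    have "lookup (?A w') x = 0"
      using arg_cong[OF w(1), of "\<lambda>p. lookup p x"] w(2) v b0 by (simp add: lookup_add lookup_single when_def)
    moreover have "?A w' + unit_exp v' = ?A (w + single e 1) + unit_exp b0"
      unfolding w(1)[symmetric] vertex_exp_add e by (simp add: ac_simps)
    ultimately have "P v'" unfolding P_def by blast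
    with Q show ?case by simp
  qed
  \<comment> \<open>Adding the relations for \<open>v - b0\<close> from \<open>P\<close> and for
    \<open>v + b0\<close> from \<open>Q\<close> eliminates \<open>b0\<close> and leaves
    \<open>2 v\<close>.\<close>
  have "\<exists>w w'. ?A w + unit_exp v + unit_exp v = ?A w' \<and> lookup (?A w) x = 0" if vx: "v \<noteq> x" for v
  proof -
    obtain w1 w1' where 1: "?A w1 + unit_exp v = ?A w1' + unit_exp b0" "lookup (?A w1) x = 0"
      using PQ[OF vx] unfolding P_def by blast
    obtain w2 w2' where 2: "?A w2 + unit_exp v + unit_exp b0 = ?A w2'" "lookup (?A w2) x = 0"
      using PQ[OF vx] unfolding Q_def by blast
    have "?A (w1 + w2) + unit_exp v + unit_exp v + unit_exp b0 = (?A w1 + unit_exp v) + (?A w2 + unit_exp v + unit_exp b0)"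
      by (simp add: vertex_exp_add ac_simps)
    also have "\<dots> = ?A (w1' + w2') + unit_exp b0"
      unfolding 1(1) 2(1) vertex_exp_add by (simp only: ac_simps)
    finally have "?A (w1 + w2) + unit_exp v + unit_exp v = ?A (w1' + w2')" by simp
    moreover have "lookup (?A (w1 + w2)) x = 0" using 1 2 by (simp add: vertex_exp_add lookup_add)
    ultimately show ?thesis by blast
  qed
  then obtain W W' where W: "\<And>v. v \<noteq> x \<Longrightarrow> ?A (W v) + unit_exp v + unit_exp v = ?A (W' v)"
    "\<And>v. v \<noteq> x \<Longrightarrow> lookup (?A (W v)) x = 0" by metis
  define \<psi> where "\<psi> v = (edge_weight \<phi> (W' v) - edge_weight \<phi> (W v)) / 2" for v
  have edge: "\<phi> e = \<psi> v + \<psi> v'" if e: "ends e = {v, v'}" "v \<noteq> v'" and ne: "v \<noteq> x" "v' \<noteq> x" for e v v'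
  proof -
    let ?E = "single e 1"
    \<comment> \<open>Twice the edge equals \<open>2 v + 2 v'\<close>, and this relation avoids
      \<open>x\<close> altogether.\<close>
    have 1: "?A (W' v + W' v') = ?A (W v + W v' + ?E + ?E)"
      unfolding vertex_exp_add edge_vertex_exp[of ends e v v', OF e] W(1)[OF ne(1), symmetric] W(1)[OF ne(2), symmetric]
      by (simp add: ac_simps)
    have "lookup (?A (W' v + W' v')) x \<le> 1"
      using ne W(2) unfolding vertex_exp_add W(1)[OF ne(1), symmetric] W(1)[OF ne(2), symmetric]
      by (simp add: lookup_add lookup_single when_def)
    from const[OF 1 this] show ?thesis
      by (simp add: edge_weight_add edge_weight_single \<psi>_def field_simps)
  qed
  have avoid: "edge_weight \<phi> w = (\<Sum>v\<in>UNIV. \<psi> v * real (lookup (?A w) v))" if w: "lookup (?A w) x = 0" for w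
  proof (rule edge_weight_pullback)
    fix e assume "e \<in> keys w"
    then have "x \<notin> ends e" using keys_vertex_exp[of e w ends] w by (auto simp: in_keys_iff)
    moreover obtain v v' where "ends e = {v, v'}" "v \<noteq> v'" using sg by (rule simple_graph_edgeE)
    ultimately show "\<phi> e = (\<Sum>v\<in>ends e. \<psi> v)" using edge[of e v v'] by auto
  qed
  \<comment> \<open>Exchanging the edge \<open>e\<close> for \<open>e'\<close> is compensated in
    \<open>G - x\<close> by a relation between \<open>q\<close> and \<open>q'\<close>. The resulting
    fiber has degree one at \<open>x\<close>, so the weight is still constant on it.\<close>
  have nbr: "\<phi> e - \<psi> q = \<phi> e' - \<psi> q'" if e: "ends e = {x, q}" "q \<noteq> x" "ends e' = {x, q'}" "q' \<noteq> x" for e e' q q'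
  proof -
    obtain w1 w1' where 1: "?A w1 + unit_exp q = ?A w1' + unit_exp b0" "lookup (?A w1) x = 0"
      using PQ[OF e(2)] unfolding P_def by blast
    obtain w2 w2' where 2: "?A w2 + unit_exp q' = ?A w2' + unit_exp b0" "lookup (?A w2) x = 0"
      using PQ[OF e(4)] unfolding P_def by blast
    define w where "w = w1 + w2'"
    define w' where "w' = w1' + w2"
    have "?A w + unit_exp q = (?A w1 + unit_exp q) + ?A w2'"
      by (simp add: w_def vertex_exp_add ac_simps)
    also have "\<dots> = ?A w1' + (?A w2' + unit_exp b0)"
      unfolding 1(1) by (simp add: ac_simps)
    also have "\<dots> = ?A w' + unit_exp q'"
      unfolding 2(1)[symmetric] by (simp add: w'_def vertex_exp_add ac_simps)
    finally have ww': "?A w + unit_exp q = ?A w' + unit_exp q'" .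
    have z: "lookup (?A w2') x = 0" "lookup (?A w1') x = 0"
      using arg_cong[OF 1(1), of "\<lambda>p. lookup p x"] arg_cong[OF 2(1), of "\<lambda>p. lookup p x"] 1(2) 2(2) e b0
      by (auto simp: lookup_add lookup_single when_def)
    then have zw: "lookup (?A w) x = 0" "lookup (?A w') x = 0"
      using 1(2) 2(2) by (simp_all add: w_def w'_def vertex_exp_add lookup_add)
    have E: "?A (single e 1) = unit_exp x + unit_exp q" "?A (single e' 1) = unit_exp x + unit_exp q'"
      using e by (auto intro!: edge_vertex_exp)
    have 3: "?A (single e 1 + w) = ?A (single e' 1 + w')"
      using arg_cong[OF ww', of "\<lambda>p. p + unit_exp x"] by (simp only: vertex_exp_add E ac_simps)
    have "lookup (?A (single e 1 + w)) x \<le> 1"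
      using zw e by (simp add: vertex_exp_add E lookup_add lookup_single when_def)
    from const[OF 3 this] have "\<phi> e + edge_weight \<phi> w = \<phi> e' + edge_weight \<phi> w'"
      by (simp add: edge_weight_add edge_weight_single)
    moreover have "edge_weight \<phi> w + \<psi> q = edge_weight \<phi> w' + \<psi> q'"
    proof -
      have unit: "(\<Sum>v\<in>UNIV. \<psi> v * real (lookup (unit_exp r) v)) = \<psi> r" for r
      proof -
        have "(\<Sum>v\<in>UNIV. \<psi> v * real (lookup (unit_exp r) v)) = (\<Sum>v\<in>UNIV. if v = r then \<psi> r else 0)"
          by (intro sum.cong) (auto simp: lookup_single when_def)
        then show ?thesis by simp
      qed
      have "(\<Sum>v\<in>UNIV. \<psi> v * real (lookup (?A w + unit_exp q) v)) = (\<Sum>v\<in>UNIV. \<psi> v * real (lookup (?A w' + unit_exp q') v))"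
        unfolding ww' ..
      then show ?thesis
        unfolding avoid[OF zw(1)] avoid[OF zw(2)]
        by (simp add: lookup_add distrib_left sum.distrib unit del: lookup_single_not_eq)
    qed
    ultimately show ?thesis by linarith
  qed
  \<comment> \<open>By \<open>nbr\<close> all edges at \<open>x\<close> give the same value here, so
    any of them determines the potential at \<open>x\<close>.\<close>
  define \<psi>' where "\<psi>' = \<psi>(x := (SOME k. \<exists>e q. ends e = {x, q} \<and> q \<noteq> x \<and> k = \<phi> e - \<psi> q))"
  have pull: "\<phi> e = (\<Sum>v\<in>ends e. \<psi>' v)" for e
  proof -
    obtain v v' where e: "ends e = {v, v'}" "v \<noteq> v'" using sg by (rule simple_graph_edgeE)
    show ?thesis
    proof (cases "x \<in> ends e")
      case False
      then show ?thesis using e edge[of e v v'] by (auto simp: \<psi>'_def)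
    next
      case True
      then obtain q where q: "ends e = {x, q}" "q \<noteq> x" using e by auto
      have "\<psi>' x = \<phi> e - \<psi> q"
        unfolding \<psi>'_def fun_upd_same
        by (rule someI2[of _ "\<phi> e - \<psi> q"]) (use q nbr in blast)+
      then show ?thesis using q by (simp add: \<psi>'_def)
    qed
  qed
  show ?thesis unfolding edge_weight_pullback[OF pull] eq ..
qed

section \<open>Edges leaving a set of vertices\<close>

lemma sum_vertex_exp_eq:
  fixes ends :: "'e::finite \<Rightarrow> 'v::finite set"
  shows "(\<Sum>v\<in>B. lookup (vertex_exp ends u) v) = (\<Sum>e\<in>UNIV. card (ends e \<inter> B) * lookup u e)"
proof -
  have "(\<Sum>v\<in>B. lookup (vertex_exp ends u) v) = (\<Sum>v\<in>B. \<Sum>e\<in>UNIV. if v \<in> ends e then lookup u e else 0)"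
    by (simp add: lookup_vertex_exp flip: sum.inter_filter)
  also have "\<dots> = (\<Sum>e\<in>UNIV. \<Sum>v\<in>B. if v \<in> ends e then lookup u e else 0)"
    by (rule sum.swap)
  also have "\<dots> = (\<Sum>e\<in>UNIV. card (ends e \<inter> B) * lookup u e)"
    by (intro sum.cong refl) (simp add: sum.If_cases Int_commute)
  finally show ?thesis .
qed

definition leaving :: "('e::finite \<Rightarrow> 'v set) \<Rightarrow> 'v set \<Rightarrow> ('e \<Rightarrow>\<^sub>0 nat) \<Rightarrow> nat" where
  "leaving ends A u = (\<Sum>e | card (ends e \<inter> A) = 1. lookup u e)"

text \<open>An edge inside \<open>A\<close> adds two to the degree sum over \<open>A\<close>, an
  edge leaving \<open>A\<close> adds one.\<close>

lemma leaving_parity: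
  fixes ends :: "'e::finite \<Rightarrow> 'v::finite set"
  assumes "simple_graph ends"
  shows "even (leaving ends A u) \<longleftrightarrow> even (\<Sum>v\<in>A. lookup (vertex_exp ends u) v)"
proof -
  have le: "card (ends e \<inter> A) \<le> 2" for e
    using assms card_mono[of "ends e" "ends e \<inter> A"] by (simp add: simple_graph_def)
  have "(\<Sum>e\<in>UNIV. card (ends e \<inter> A) * lookup u e) =
      (\<Sum>e\<in>UNIV. (if card (ends e \<inter> A) = 1 then lookup u e else 0) + 2 * (if card (ends e \<inter> A) = 2 then lookup u e else 0))"
  proof (intro sum.cong refl)
    fix e
    have "card (ends e \<inter> A) = 0 \<or> card (ends e \<inter> A) = 1 \<or> card (ends e \<inter> A) = 2" using le[of e] by linarith
    then show "card (ends e \<inter> A) * lookup u e = (if card (ends e \<inter> A) = 1 then lookup u e else 0) +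
        2 * (if card (ends e \<inter> A) = 2 then lookup u e else 0)" by auto
  qed
  also have "\<dots> = leaving ends A u + 2 * (\<Sum>e\<in>UNIV. if card (ends e \<inter> A) = 2 then lookup u e else 0)"
    unfolding sum.distrib sum_distrib_left[symmetric] by (simp add: leaving_def sum.If_cases)
  finally show ?thesis by (simp add: sum_vertex_exp_eq)
qed

lemma leaving_eq_0:
  fixes ends :: "'e::finite \<Rightarrow> 'v::finite set"
  assumes "simple_graph ends" "keys (vertex_exp ends u) \<subseteq> A \<or> keys (vertex_exp ends u) \<inter> A = {}"
  shows "leaving ends A u = 0"
  unfolding leaving_def
proof (intro sum.neutral ballI)
  fix e assume e: "e \<in> {e. card (ends e \<inter> A) = 1}"
  show "lookup u e = 0"
  proof (rule ccontr)
    assume "lookup u e \<noteq> 0"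
    then have "ends e \<subseteq> keys (vertex_exp ends u)" by (intro keys_vertex_exp) (simp add: in_keys_iff)
    then have "ends e \<inter> A = ends e \<or> ends e \<inter> A = {}" using assms(2) by blast
    then show False using e assms(1) by (auto simp: simple_graph_def)
  qed
qed

lemma leaving_add: "leaving ends A (u + w) = leaving ends A u + leaving ends A w"
  by (simp add: leaving_def lookup_add sum.distrib)

lemma edge_weight_leaving:
  "edge_weight (\<lambda>e. of_bool (card (ends e \<inter> A) = 1)) u = real (leaving ends A u)"
proof -
  have "edge_weight (\<lambda>e. of_bool (card (ends e \<inter> A) = 1)) u =
      (\<Sum>e\<in>UNIV. if card (ends e \<inter> A) = 1 then real (lookup u e) else 0)"
    unfolding edge_weight_def by (intro sum.cong) auto
  then show ?thesis by (simp add: leaving_def flip: sum.inter_filter)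
qed

theorem odd_cycle_condition_of_complete_intersection:
  fixes ends :: "'e::finite \<Rightarrow> 'v::finite set"
  assumes sg: "simple_graph ends" and bic: "biconnected ends"
    and ci: "complete_intersection ends TYPE('k::field)"
  shows "odd_cycle_condition ends"
  unfolding odd_cycle_condition_def
proof (intro allI impI, rule ccontr)
  fix c1 c2
  assume c: "chordless_cycle ends c1 \<and> odd (length c1) \<and> chordless_cycle ends c2 \<and> odd (length c2)"
    and bad: "\<not> (set c1 \<inter> set c2 \<noteq> {} \<or> (\<exists>u\<in>set c1. \<exists>w\<in>set c2. adj ends u w))"
  let ?A = "vertex_exp ends" and ?S = "edge_semigroup ends"
  have cw: "closed_walk ends c1" "closed_walk ends c2"
    using c by (auto intro: is_cycle_closed_walk simp: chordless_cycle_def)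
  \<comment> \<open>A walk staying in this region uses no edge that leaves
    \<open>c1\<close>.\<close>
  define far where "far = {v. v \<notin> set c1 \<and> (\<forall>a\<in>set c1. \<not> adj ends a v)}"
  have c2_far: "set c2 \<subseteq> far" using bad by (auto simp: far_def)
  obtain b0 bs where c2: "c2 = b0 # bs" using cw(2) by (cases c2) (auto simp: closed_walk_def)
  have bs: "list_exp bs \<in> ?S" "list_exp bs + unit_exp b0 + unit_exp b0 \<in> ?S"
    using closed_walk_tl_in_edge_semigroup[of ends b0 bs] cw(2) c c2 by auto
  have conn: "reach_in ends UNIV u w" for u w
    using bic by (simp add: biconnected_def connected_graph_def)
  \<comment> \<open>What is reached from \<open>b0\<close> inside \<open>far\<close> cannot be the
    whole connected graph, since \<open>c1\<close> lies outside; \<open>x\<close> is a vertex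
    adjacent to it. As \<open>q\<close> is far, \<open>x\<close> is not on \<open>c1\<close>; as
    \<open>x\<close> is not far, it is a neighbour of \<open>c1\<close>.\<close>
  obtain q x where qx: "reach_in ends far b0 q" "\<not> reach_in ends far b0 x" "adj ends q x"
  proof -
    have "\<exists>q x. reach_in ends far b0 q \<and> \<not> reach_in ends far b0 x \<and> adj ends q x"
    proof (rule ccontr)
      assume closed: "\<not> ?thesis"
      have all: "reach_in ends far b0 v" for v
        using conn[of b0 v] unfolding reach_in_def[of ends UNIV]
      proof (induction rule: rtranclp_induct)
        case base
        show ?case by (simp add: reach_in_def)
      next
        case (step y z)
        then show ?case using closed by blast
      qed
      have far_reach: "v \<in> far" if "reach_in ends far b0 v" for v
        using that unfolding reach_in_def
        by (induction rule: rtranclp_induct) (use c2_far c2 in auto)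
      obtain a where "a \<in> set c1" using cw(1) by (cases c1) (auto simp: closed_walk_def)
      then show False using far_reach[OF all[of a]] by (simp add: far_def)
    qed
    then show thesis using that by blast
  qed
  \<comment> \<open>Propagates along a path the pair of degrees given by the odd closed walk
    \<open>c2\<close>: passing from \<open>v\<close> to \<open>v'\<close> replaces \<open>y\<close>
    by \<open>y + 2 v\<close>, and \<open>y + 2 v + 2 v'\<close> is \<open>y\<close> plus twice the
    edge.\<close>
  have W: "v \<in> far \<and> (\<exists>y\<in>?S. keys y \<subseteq> far \<and> y + unit_exp v + unit_exp v \<in> ?S)" if "reach_in ends far b0 v" for v
    using that unfolding reach_in_def
  proof (induction rule: rtranclp_induct)
    case base
    show ?case using bs c2_far c2 by (auto intro!: bexI[of _ "list_exp bs"] simp: keys_list_exp)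
  next
    case (step v v')
    then obtain y where y: "y \<in> ?S" "keys y \<subseteq> far" "y + unit_exp v + unit_exp v \<in> ?S" by blast
    let ?y = "y + unit_exp v + unit_exp v"
    have e: "unit_exp v + unit_exp v' \<in> ?S" using step by (intro edge_in_edge_semigroup) auto
    have "?y + unit_exp v' + unit_exp v' = y + ((unit_exp v + unit_exp v') + (unit_exp v + unit_exp v'))"
      by (simp add: ac_simps)
    then have "?y + unit_exp v' + unit_exp v' \<in> ?S" using y(1) e by (simp only: add_in_edge_semigroup)
    moreover have "keys ?y \<subseteq> far"
      using y(2) step.hyps(2) by (auto simp: in_keys_iff lookup_add lookup_single when_def subset_iff split: if_splits)
    ultimately show ?case using y(3) step.hyps(2) by blast
  qed
  obtain y0 where y0: "y0 \<in> ?S" "keys y0 \<subseteq> far" "y0 + unit_exp q + unit_exp q \<in> ?S" and q: "q \<in> far"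
    using W[OF qx(1)] by blast
  have x_far: "x \<notin> far"
  proof
    assume "x \<in> far"
    then have "reach_in ends far b0 x"
      using qx(1,3) q unfolding reach_in_def by (auto intro: rtranclp.rtrancl_into_rtrancl)
    then show False using qx(2) by simp
  qed
  have x_c1: "x \<notin> set c1" using q adj_sym[OF qx(3)] by (auto simp: far_def)
  obtain a where a: "a \<in> set c1" "adj ends a x" using x_far x_c1 by (auto simp: far_def)
  \<comment> \<open>The last step of the same propagation, from \<open>q\<close> to
    \<open>x\<close>; the support of \<open>y\<close> still avoids \<open>x\<close>.\<close>
  define y where "y = y0 + unit_exp q + unit_exp q"
  have y: "y \<in> ?S" "keys y \<subseteq> far"
    using y0 q by (auto simp: y_def in_keys_iff lookup_add lookup_single when_def subset_iff split: if_splits)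
  have y2: "y + unit_exp x + unit_exp x \<in> ?S"
  proof -
    have e: "unit_exp q + unit_exp x \<in> ?S" using qx(3) by (rule edge_in_edge_semigroup)
    have "y + unit_exp x + unit_exp x = y0 + ((unit_exp q + unit_exp x) + (unit_exp q + unit_exp x))"
      by (simp add: y_def ac_simps)
    then show ?thesis using y0(1) e by (simp only: add_in_edge_semigroup)
  qed
  obtain as where as: "closed_walk ends (a # as)" "mset (a # as) = mset c1"
    using closed_walk_rotate[OF cw(1) a(1)] by blast
  have set_as: "set (a # as) = set c1" and len_as: "odd (length (a # as))"
    using as(2) c by (metis mset_eq_setD, metis mset_eq_length)
  have asS: "list_exp as \<in> ?S" "list_exp as + unit_exp a + unit_exp a \<in> ?S"
    using closed_walk_tl_in_edge_semigroup[OF as(1) len_as] by auto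
  have ne: "ends e \<noteq> {}" for e using sg unfolding simple_graph_def by (metis card.empty zero_neq_numeral)
  \<comment> \<open>Here \<open>edge_weight_extends\<close> applies because \<open>x\<close> is not
    a cut vertex and the odd closed walk \<open>c2\<close> avoids it.\<close>
  have small: "lookup (?A z) x \<le> 1" if "z \<in> minimal_moves ends" for z
  proof (rule complete_intersection_minimal_moves[OF ci ne _ _ that, of "\<lambda>b. lookup b x \<le> 1"])
    fix b b' :: "'v \<Rightarrow>\<^sub>0 nat" assume "lookup (b + b') x \<le> 1"
    then show "lookup b x \<le> 1" by (simp add: lookup_add)
  next
    fix \<phi> :: "'e \<Rightarrow> real" and u u'
    assume const: "\<And>u u'. ?A u = ?A u' \<Longrightarrow> lookup (?A u) x \<le> 1 \<Longrightarrow> edge_weight \<phi> u = edge_weight \<phi> u'"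
      and eq: "?A u = ?A u'"
    have b0x: "b0 \<noteq> x" using x_far c2_far c2 by auto
    have reach: "reach_in ends (UNIV - {x}) b0 v" if "v \<noteq> x" for v
      using bic conn[of b0 v] that b0x unfolding biconnected_def cut_vertex_def by blast
    obtain w0 w0' where w0: "?A w0 = list_exp bs" "?A w0' = list_exp bs + unit_exp b0 + unit_exp b0"
      using bs unfolding edge_semigroup_def by (metis imageE)
    then have w0': "?A w0 + unit_exp b0 + unit_exp b0 = ?A w0'" by (simp only:)
    have x0: "lookup (?A w0) x = 0"
      unfolding w0 using x_far c2_far c2 keys_list_exp[of bs] by (auto simp: in_keys_iff)
    show "edge_weight \<phi> u = edge_weight \<phi> u'"
      by (rule edge_weight_extends[OF sg reach b0x w0' x0 const eq])
  qed
  \<comment> \<open>The degree of the even closed walk around \<open>c1\<close>, from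
    \<open>a\<close> to \<open>x\<close>, along the path to \<open>c2\<close>, around it and back.
    Below, \<open>u\<close> uses the edge \<open>e0\<close> between \<open>a\<close> and
    \<open>x\<close> twice, whereas \<open>u'\<close> splits into a part on \<open>c1\<close> and a
    part away from it.\<close>
  define b where "b = list_exp as + unit_exp a + unit_exp a + (y + unit_exp x + unit_exp x)"
  obtain u1 where u1: "?A u1 = list_exp as" using asS unfolding edge_semigroup_def by (metis imageE)
  obtain u2 where u2: "?A u2 = y" using y unfolding edge_semigroup_def by (metis imageE)
  obtain u3 where u3: "?A u3 = list_exp as + unit_exp a + unit_exp a" using asS unfolding edge_semigroup_def by (metis imageE)
  obtain u4 where u4: "?A u4 = y + unit_exp x + unit_exp x" using y2 unfolding edge_semigroup_def by (metis imageE)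
  obtain e0 where e0: "ends e0 = {a, x}" "a \<noteq> x" using a(2) by (auto simp: adj_def)
  define u where "u = u1 + u2 + (single e0 1 + single e0 1)"
  define u' where "u' = u3 + u4"
  have Au: "?A u = b" "?A u' = b"
    by (simp_all only: u_def u'_def b_def vertex_exp_add u1 u2 u3 u4 edge_vertex_exp[of ends e0 a x, OF e0] ac_simps)
  have "leaving ends (set c1) u' = 0"
  proof -
    have "?A u3 = list_exp (as @ [a, a])" by (simp add: u3 add.assoc)
    then have "keys (?A u3) = set (as @ [a, a])" by (simp only: keys_list_exp)
    then have "keys (?A u3) \<subseteq> set c1" using set_as by auto
    moreover have "keys (?A u4) \<inter> set c1 = {}"
      unfolding u4 using y(2) x_c1
      by (auto simp: in_keys_iff lookup_add lookup_single when_def far_def subset_iff split: if_splits)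
    ultimately show ?thesis using leaving_eq_0[OF sg] by (simp add: u'_def leaving_add)
  qed
  moreover have "leaving ends (set c1) u \<noteq> 0"
  proof -
    have "ends e0 \<inter> set c1 = {a}" using e0 a x_c1 by auto
    then have "1 \<le> leaving ends (set c1) (single e0 1)"
      unfolding leaving_def by (intro order_trans[OF _ member_le_sum[of e0]]) auto
    then show ?thesis by (simp add: u_def leaving_add)
  qed
  moreover have "edge_weight (\<lambda>e. of_bool (card (ends e \<inter> set c1) = 1)) u = edge_weight (\<lambda>e. of_bool (card (ends e \<inter> set c1) = 1)) u'"
  proof (rule edge_weight_constant_on_fibers[where D = "\<lambda>d. \<forall>v. lookup d v \<le> lookup b v", OF ne])
    fix d d' :: "'v \<Rightarrow>\<^sub>0 nat" assume "\<forall>v. lookup (d + d') v \<le> lookup b v"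
    then show "\<forall>v. lookup d v \<le> lookup b v" by (auto simp: lookup_add intro: add_leD1)
  next
    fix z assume z: "z \<in> minimal_moves ends" "\<forall>v. lookup (?A z) v \<le> lookup b v"
    \<comment> \<open>Outside \<open>c1\<close> and \<open>far\<close> the degree \<open>b\<close>
      is nonzero only at \<open>x\<close>. So in a fiber of degree below \<open>b\<close> every edge
      leaving \<open>c1\<close> ends at \<open>x\<close>, and their number is at most the degree at
      \<open>x\<close>, which \<open>small\<close> bounds by one.\<close>
    have le1: "leaving ends (set c1) w \<le> 1" if w: "?A w = ?A z" for w
    proof -
      have "leaving ends (set c1) w \<le> lookup (?A w) x"
      proof -
        have "x \<in> ends e" if e: "card (ends e \<inter> set c1) = 1" "e \<in> keys w" for e
        proof -
          obtain v v' where v: "ends e = {v, v'}" "v \<noteq> v'" using sg by (rule simple_graph_edgeE)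
          obtain a' where a': "ends e \<inter> set c1 = {a'}" using e(1) by (rule card_1_singletonE)
          define r where "r = (if a' = v then v' else v)"
          have r: "ends e = {a', r}" "a' \<noteq> r" "a' \<in> set c1" "r \<notin> set c1"
            using v a' by (auto simp: r_def split: if_splits)
          have "lookup (?A w) r \<noteq> 0"
            using keys_vertex_exp[OF e(2), of ends] r(1) by (auto simp: in_keys_iff)
          then have "lookup b r \<noteq> 0" using z(2) w by (metis le_zero_eq)
          moreover have "r \<notin> far" using r by (auto simp: far_def adj_def)
          then have "lookup y r = 0" using y(2) by (auto simp: in_keys_iff)
          moreover have "lookup (list_exp as) r = 0"
            using r(4) set_as keys_list_exp[of as] by (auto simp: in_keys_iff)
          moreover have "r \<noteq> a" using r(4) a(1) by auto
          ultimately have "r = x"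
            unfolding b_def by (simp add: lookup_add lookup_single when_def split: if_splits)
          then show ?thesis using r by simp
        qed
        then have sub: "{e. card (ends e \<inter> set c1) = 1} \<inter> keys w \<subseteq> {e. x \<in> ends e}" by blast
        have "leaving ends (set c1) w = (\<Sum>e\<in>{e. card (ends e \<inter> set c1) = 1} \<inter> keys w. lookup w e)"
          unfolding leaving_def by (intro sum.mono_neutral_right) (auto simp: in_keys_iff)
        also have "\<dots> \<le> lookup (?A w) x"
          unfolding lookup_vertex_exp using sub by (intro sum_mono2) auto
        finally show ?thesis .
      qed
      also have "\<dots> \<le> 1" using small[OF z(1)] w by simp
      finally show ?thesis .
    qed
    have "even (leaving ends (set c1) z) = even (leaving ends (set c1) (fiber_root ends z))"
      by (simp add: leaving_parity[OF sg] vertex_exp_fiber_root)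
    moreover have "leaving ends (set c1) z \<le> 1" "leaving ends (set c1) (fiber_root ends z) \<le> 1"
      by (auto intro!: le1 simp: vertex_exp_fiber_root)
    ultimately have "leaving ends (set c1) z = leaving ends (set c1) (fiber_root ends z)"
      by (metis One_nat_def even_zero le_SucE le_zero_eq odd_one)
    then show "edge_weight (\<lambda>e. of_bool (card (ends e \<inter> set c1) = 1)) z =
        edge_weight (\<lambda>e. of_bool (card (ends e \<inter> set c1) = 1)) (fiber_root ends z)"
      by (simp add: edge_weight_leaving)
  qed (use Au in auto)
  ultimately show False by (simp add: edge_weight_leaving)
qed

subsection \<open>Normality of the edge semigroup\<close>

lemma hall_marriage:
  assumes "finite I" "\<And>i. i \<in> I \<Longrightarrow> finite (N i)"
    and "\<And>J. J \<subseteq> I \<Longrightarrow> card J \<le> card (\<Union>(N ` J))"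
  shows "\<exists>f. inj_on f I \<and> (\<forall>i\<in>I. f i \<in> N i)"
  using assms
proof (induction I arbitrary: N rule: finite_psubset_induct)
  case (psubset I)
  show ?case
  proof (cases "\<exists>J. J \<noteq> {} \<and> J \<subset> I \<and> card (\<Union>(N ` J)) = card J")
    case True
    \<comment> \<open>A tight set is matched within its own neighbourhood. Deleting that
      neighbourhood preserves the condition on the rest, because enlarging \<open>L\<close> by
      \<open>J\<close> adds \<open>card J\<close> elements and \<open>?U\<close> has exactly that
      size.\<close>
    then obtain J where J: "J \<noteq> {}" "J \<subset> I" "card (\<Union>(N ` J)) = card J" by blast
    let ?U = "\<Union>(N ` J)"
    have fin: "finite (\<Union>(N ` L))" if "L \<subseteq> I" for L
      using that psubset.hyps psubset.prems(1) finite_subset by blast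
    obtain f where f: "inj_on f J" "\<forall>i\<in>J. f i \<in> N i"
      using psubset.IH[of J N] J psubset.prems by blast
    have "\<exists>g. inj_on g (I - J) \<and> (\<forall>i\<in>I - J. g i \<in> N i - ?U)"
    proof (rule psubset.IH)
      show "I - J \<subset> I" using J by blast
      show "finite (N i - ?U)" if "i \<in> I - J" for i using psubset.prems(1) that by blast
      fix L assume L: "L \<subseteq> I - J"
      have "\<Union>((\<lambda>i. N i - ?U) ` L) = \<Union>(N ` (L \<union> J)) - ?U" by blast
      then have "card (\<Union>((\<lambda>i. N i - ?U) ` L)) = card (\<Union>(N ` (L \<union> J))) - card ?U"
        using fin[of J] J(2) by (simp only:) (rule card_Diff_subset, auto)
      moreover have "card (L \<union> J) \<le> card (\<Union>(N ` (L \<union> J)))"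
        using L J(2) by (intro psubset.prems(2)) blast
      moreover have "card (L \<union> J) = card L + card J"
        using L J(2) psubset.hyps by (intro card_Un_disjoint) (auto intro: finite_subset)
      ultimately show "card L \<le> card (\<Union>((\<lambda>i. N i - ?U) ` L))" using J(3) by linarith
    qed
    then obtain g where g: "inj_on g (I - J)" "\<forall>i\<in>I - J. g i \<in> N i - ?U" by blast
    define h where "h i = (if i \<in> J then f i else g i)" for i
    have "inj_on h I"
    proof (rule inj_onI)
      fix i j assume ij: "i \<in> I" "j \<in> I" "h i = h j"
      have "h k \<in> ?U \<longleftrightarrow> k \<in> J" if "k \<in> I" for k using f(2) g(2) that by (auto simp: h_def)
      then have "i \<in> J \<longleftrightarrow> j \<in> J" using ij by metis
      then show "i = j" using ij f(1) g(1) by (auto simp: h_def inj_on_def split: if_splits)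
    qed
    moreover have "\<forall>i\<in>I. h i \<in> N i" using f g by (auto simp: h_def)
    ultimately show ?thesis by blast
  next
    case False
    show ?thesis
    proof (cases "I = {}")
      case False
      \<comment> \<open>Without tight sets every proper nonempty subset has a neighbour to spare, so
        \<open>i0\<close> may take any \<open>y\<close> in \<open>N i0\<close>.\<close>
      then obtain i0 where i0: "i0 \<in> I" by blast
      have "card {i0} \<le> card (\<Union>(N ` {i0}))" using i0 by (intro psubset.prems(2)) simp
      then have "N i0 \<noteq> {}" by auto
      then obtain y where y: "y \<in> N i0" by blast
      have "\<exists>g. inj_on g (I - {i0}) \<and> (\<forall>i\<in>I - {i0}. g i \<in> N i - {y})"
      proof (rule psubset.IH)
        show "I - {i0} \<subset> I" using i0 by blast
        show "finite (N i - {y})" if "i \<in> I - {i0}" for i using psubset.prems(1) that by blast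
        fix L assume L: "L \<subseteq> I - {i0}"
        show "card L \<le> card (\<Union>((\<lambda>i. N i - {y}) ` L))"
        proof (cases "L = {}")
          case False
          have "L \<subset> I" using L i0 by blast
          then have "card (\<Union>(N ` L)) \<noteq> card L"
            using \<open>\<not> (\<exists>J. J \<noteq> {} \<and> J \<subset> I \<and> card (\<Union>(N ` J)) = card J)\<close> False by blast
          moreover have "card L \<le> card (\<Union>(N ` L))" using \<open>L \<subset> I\<close> by (intro psubset.prems(2)) blast
          moreover have "\<Union>((\<lambda>i. N i - {y}) ` L) = \<Union>(N ` L) - {y}" by blast
          moreover have "card (\<Union>(N ` L) - {y}) \<ge> card (\<Union>(N ` L)) - 1"
            by (metis One_nat_def diff_le_self card_Diff_singleton_if order_refl)
          ultimately show ?thesis by simp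
        qed simp
      qed
      then obtain g where g: "inj_on g (I - {i0})" "\<forall>i\<in>I - {i0}. g i \<in> N i - {y}" by blast
      have "inj_on (g(i0 := y)) I" using g by (auto simp: inj_on_def)
      moreover have "\<forall>i\<in>I. (g(i0 := y)) i \<in> N i" using g y by auto
      ultimately show ?thesis by blast
    qed simp
  qed
qed

section \<open>Chordless odd cycles inside odd closed walks\<close>

lemma successively_shortcut:
  assumes "successively P (xs @ y # ys @ z # zs)" "y = z \<or> P y z"
  shows "y = z \<Longrightarrow> successively P (xs @ y # zs)" "P y z \<Longrightarrow> successively P (xs @ y # z # zs)"
    "successively P (y # ys @ [z])"
  using assms by (auto simp: successively_append_iff successively_Cons hd_append split: if_splits)

text \<open>A shortest odd closed walk on the vertices of \<open>c\<close> is a chordless cycle: a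
  repeated vertex or a chord would cut it into two shorter closed walks, one of which is
  odd.\<close>

lemma odd_closed_walk_contains_chordless:
  assumes "closed_walk ends c" "odd (length c)"
  obtains d where "chordless_cycle ends d" "odd (length d)" "set d \<subseteq> set c"
proof -
  define P where "P d \<longleftrightarrow> closed_walk ends d \<and> odd (length d) \<and> set d \<subseteq> set c" for d
  have "P c" using assms by (simp add: P_def)
  then obtain d where d: "P d" and min: "\<And>d'. P d' \<Longrightarrow> length d \<le> length d'"
    using ex_has_least_nat[of P c length] by blast
  have cw: "successively (adj ends) (d @ [hd d])" "d \<noteq> []" "odd (length d)" "set d \<subseteq> set c"
    using d by (auto simp: P_def closed_walk_def)
  have irr: "\<not> adj ends v v" for v by (simp add: adj_def)
  have split_ex: False
    if s: "closed_walk ends d1" "closed_walk ends d2" "set d1 \<subseteq> set d" "set d2 \<subseteq> set d"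
      "length d1 < length d" "length d2 < length d" "odd (length d1 + length d2)" for d1 d2
  proof -
    have "P d1 \<or> P d2" using s cw by (auto simp: P_def)
    then show False using min[of d1] min[of d2] s by auto
  qed
  have dist: "distinct d"
  proof (rule ccontr)
    assume "\<not> distinct d"
    then obtain xs ys zs y where dec: "d = xs @ [y] @ ys @ [y] @ zs" using not_distinct_decomp by blast
    have s: "successively (adj ends) (xs @ y # ys @ y # zs @ [hd d])" using cw(1) by (simp add: dec)
    have "closed_walk ends (y # ys)"
      using successively_shortcut(3)[OF s] by (simp add: closed_walk_def)
    moreover have "hd d = hd (xs @ y # zs)" by (simp add: dec hd_append)
    then have "closed_walk ends (xs @ y # zs)"
      using successively_shortcut(1)[OF s] by (simp add: closed_walk_def)
    ultimately show False
      using cw(3) by (intro split_ex[of "y # ys" "xs @ y # zs"]) (auto simp: dec)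
  qed
  have "length d \<noteq> 1"
    using cw(1) irr by (auto simp: length_Suc_conv One_nat_def)
  moreover have "length d \<noteq> 0" "length d \<noteq> 2" using cw(2,3) by auto
  ultimately have len: "length d \<ge> 3" by linarith
  have nxt: "adj ends (d ! i) (d ! ((i + 1) mod length d))" if "i < length d" for i
  proof -
    have "adj ends ((d @ [hd d]) ! i) ((d @ [hd d]) ! Suc i)"
      using that by (intro successively_nth[OF cw(1)]) simp
    then show ?thesis
      using that cw(2) by (cases "Suc i = length d") (auto simp: nth_append hd_conv_nth One_nat_def)
  qed
  have chord: "j = (i + 1) mod length d \<or> i = (j + 1) mod length d"
    if ij: "i < j" "j < length d" "adj ends (d ! i) (d ! j)" for i j
  proof (rule ccontr)
    assume no: "\<not> ?thesis"
    define xs where "xs = take i d"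
    define ys where "ys = take (j - Suc i) (drop (Suc i) d)"
    define zs where "zs = drop (Suc j) d"
    have "drop (Suc i) d = ys @ d ! j # zs"
      using id_take_nth_drop[of "j - Suc i" "drop (Suc i) d"] ij by (simp add: ys_def zs_def)
    then have dec: "d = xs @ d ! i # ys @ d ! j # zs"
      using id_take_nth_drop[of i d] ij by (simp add: xs_def)
    have lens: "length xs = i" "length ys = j - Suc i" "length zs = length d - Suc j"
      using ij by (auto simp: xs_def ys_def zs_def)
    \<comment> \<open>This and the next claim say that both arcs between the ends of the chord have
      inner vertices. So both arcs, closed up by the chord, are shorter than \<open>d\<close>; their
      lengths add up to \<open>length d + 2\<close>, which is odd.\<close>
    have "ys \<noteq> []"
    proof
      assume "ys = []"
      then have "j = Suc i" using lens(2) ij by auto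
      then show False using no ij by (simp add: One_nat_def)
    qed
    moreover have "xs \<noteq> [] \<or> zs \<noteq> []"
    proof (rule ccontr)
      assume "\<not> ?thesis"
      then have "i = 0" "Suc j = length d" using lens ij by auto
      then show False using no by (simp add: One_nat_def)
    qed
    moreover have len: "length d = length xs + length ys + length zs + 2"
      by (subst dec) simp
    moreover have s: "successively (adj ends) (xs @ d ! i # ys @ d ! j # zs @ [hd d])"
      using cw(1) by (subst (asm) (1) dec) simp
    have "closed_walk ends (d ! i # ys @ [d ! j])"
      using successively_shortcut(3)[OF s] adj_sym[OF ij(3)] ij(3)
        successively_append_iff[of "adj ends" "d ! i # ys @ [d ! j]" "[d ! i]"]
      by (simp add: closed_walk_def)
    moreover have "hd d = hd (xs @ d ! i # d ! j # zs)"
      by (subst dec) (simp add: hd_append)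
    then have "closed_walk ends (xs @ d ! i # d ! j # zs)"
      using successively_shortcut(2)[OF s] ij(3) by (simp add: closed_walk_def)
    moreover have "set xs \<subseteq> set d" "set ys \<subseteq> set d" "set zs \<subseteq> set d" "d ! i \<in> set d" "d ! j \<in> set d"
      using ij by (auto simp: xs_def ys_def zs_def dest: in_set_takeD in_set_dropD)
    ultimately show False
      using cw(3) by (intro split_ex[of "d ! i # ys @ [d ! j]" "xs @ d ! i # d ! j # zs"]) auto
  qed
  have "chordless_cycle ends d"
    unfolding chordless_cycle_def is_cycle_def
  proof (intro conjI allI impI)
    fix i j assume ij: "i < length d" "j < length d" "adj ends (d ! i) (d ! j)"
    consider "i < j" | "j < i" | "i = j" by linarith
    then show "j = (i + 1) mod length d \<or> i = (j + 1) mod length d"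
    proof cases
      case 2
      then show ?thesis using chord[of j i, OF _ ij(1) adj_sym[OF ij(3)]] by (simp add: disj_commute)
    qed (use chord ij irr in auto)
  qed (use len dist nxt in auto)
  then show thesis using that cw by blast
qed

text \<open>The odd cycle condition connects chordless odd cycles inside the two walks. At a common
  vertex the walks concatenate to an even walk; otherwise the connecting edge and the even walks
  left after deleting its ends cover the sum.\<close>

lemma odd_closed_walks_in_edge_semigroup:
  fixes ends :: "'e::finite \<Rightarrow> 'v::finite set"
  assumes occ: "odd_cycle_condition ends"
    and c: "closed_walk ends c" "odd (length c)" and d: "closed_walk ends d" "odd (length d)"
  shows "list_exp c + list_exp d \<in> edge_semigroup ends"
proof -
  obtain c' where c': "chordless_cycle ends c'" "odd (length c')" "set c' \<subseteq> set c"
    using odd_closed_walk_contains_chordless[OF c] by blast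
  obtain d' where d': "chordless_cycle ends d'" "odd (length d')" "set d' \<subseteq> set d"
    using odd_closed_walk_contains_chordless[OF d] by blast
  have "set c' \<inter> set d' \<noteq> {} \<or> (\<exists>u\<in>set c'. \<exists>w\<in>set d'. adj ends u w)"
    using occ c' d' unfolding odd_cycle_condition_def by blast
  then obtain u w where u: "u \<in> set c" and w: "w \<in> set d" and uw: "u = w \<or> adj ends u w"
    using c' d' by blast
  obtain as where as: "closed_walk ends (u # as)" "mset (u # as) = mset c"
    using closed_walk_rotate[OF c(1) u] by blast
  obtain bs where bs: "closed_walk ends (w # bs)" "mset (w # bs) = mset d"
    using closed_walk_rotate[OF d(1) w] by blast
  have len: "odd (length (u # as))" "odd (length (w # bs))"
    using as bs c d by (metis mset_eq_length)+
  have sum: "list_exp c + list_exp d = list_exp (u # as) + list_exp (w # bs)"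
    using list_exp_mset[OF as(2)] list_exp_mset[OF bs(2)] by simp
  from uw show ?thesis
  proof
    assume eq: "u = w"
    have "successively (adj ends) ((u # as) @ (w # bs))"
      using as(1) bs(1) eq successively_append_iff[of "adj ends" "u # as" "[u]"]
        successively_append_iff[of "adj ends" "w # bs" "[w]"]
        successively_append_iff[of "adj ends" "u # as" "w # bs"]
      by (simp add: closed_walk_def)
    then have "list_exp ((u # as) @ (w # bs)) \<in> edge_semigroup ends"
      using len by (intro even_walk_in_edge_semigroup) auto
    then show ?thesis unfolding sum by (simp only: list_exp_simps)
  next
    assume "adj ends u w"
    then have "unit_exp u + unit_exp w \<in> edge_semigroup ends" by (rule edge_in_edge_semigroup)
    moreover have "list_exp as \<in> edge_semigroup ends" "list_exp bs \<in> edge_semigroup ends"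
      using closed_walk_tl_in_edge_semigroup(1) as(1) bs(1) len by blast+
    ultimately have "unit_exp u + unit_exp w + (list_exp as + list_exp bs) \<in> edge_semigroup ends"
      by (rule add_in_edge_semigroup[OF _ add_in_edge_semigroup])
    moreover have "list_exp c + list_exp d = unit_exp u + unit_exp w + (list_exp as + list_exp bs)"
      unfolding sum list_exp_simps by (simp only: ac_simps)
    ultimately show ?thesis by simp
  qed
qed

text \<open>The invariant for adding closed walks one at a time: one odd walk may be left over, and
  a second one pairs off with it under the odd cycle condition.\<close>

definition in_semigroup_up_to_odd :: "('e \<Rightarrow> 'v set) \<Rightarrow> ('v \<Rightarrow>\<^sub>0 nat) \<Rightarrow> bool" where
  "in_semigroup_up_to_odd ends x \<longleftrightarrow> x \<in> edge_semigroup ends \<or>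
    (\<exists>c s. closed_walk ends c \<and> odd (length c) \<and> s \<in> edge_semigroup ends \<and> x = list_exp c + s)"

lemma in_semigroup_up_to_odd_add_walk:
  fixes ends :: "'e::finite \<Rightarrow> 'v::finite set"
  assumes occ: "odd_cycle_condition ends" and x: "in_semigroup_up_to_odd ends x" and c: "closed_walk ends c"
  shows "in_semigroup_up_to_odd ends (list_exp c + x)"
proof (cases "even (length c)")
  case True
  have "successively (adj ends) c"
    using c successively_append_iff[of "adj ends" c "[hd c]"] by (simp add: closed_walk_def)
  then have cS: "list_exp c \<in> edge_semigroup ends" using True by (rule even_walk_in_edge_semigroup)
  from x consider "x \<in> edge_semigroup ends" |
    d s where "closed_walk ends d" "odd (length d)" "s \<in> edge_semigroup ends" "x = list_exp d + s"
    unfolding in_semigroup_up_to_odd_def by blast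
  then show ?thesis
  proof cases
    case 1
    then show ?thesis using cS by (simp add: in_semigroup_up_to_odd_def add_in_edge_semigroup)
  next
    case 2
    then have "list_exp c + x = list_exp d + (list_exp c + s)" by (simp add: ac_simps)
    moreover have "list_exp c + s \<in> edge_semigroup ends" using cS 2 by (intro add_in_edge_semigroup)
    ultimately show ?thesis using 2 unfolding in_semigroup_up_to_odd_def by blast
  qed
next
  case False
  from x consider "x \<in> edge_semigroup ends" |
    d s where "closed_walk ends d" "odd (length d)" "s \<in> edge_semigroup ends" "x = list_exp d + s"
    unfolding in_semigroup_up_to_odd_def by blast
  then show ?thesis
  proof cases
    case 1
    then show ?thesis using False c unfolding in_semigroup_up_to_odd_def by blast
  next
    case 2
    have "list_exp c + x = (list_exp c + list_exp d) + s" by (simp add: 2 add.assoc)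
    moreover have "\<dots> \<in> edge_semigroup ends"
      using 2 False c occ by (intro add_in_edge_semigroup odd_closed_walks_in_edge_semigroup)
    ultimately show ?thesis by (simp add: in_semigroup_up_to_odd_def)
  qed
qed

lemma cycle_decomp_permutes: "cycle_decomp I p \<Longrightarrow> p permutes I \<and> finite I"
proof (induction rule: cycle_decomp.induct)
  case (comp I p cs)
  then have "p permutes set cs \<union> I" "cycle_of_list cs permutes set cs \<union> I"
    using cycle_permutes[of cs] by (auto intro: permutes_subset)
  then have "cycle_of_list cs \<circ> p permutes set cs \<union> I" by (rule permutes_compose)
  with comp.IH show ?case by (metis finite_UnI finite_set)
qed (simp add: fun_eq_iff)

text \<open>Each cycle of the permutation, read through the labels \<open>l\<close>, is a closed
  walk. Labels may repeat, as several elements of \<open>X\<close> can be copies of one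
  vertex.\<close>

lemma permutation_exponent:
  fixes ends :: "'e::finite \<Rightarrow> 'v::finite set" and l :: "'a \<Rightarrow> 'v"
  assumes occ: "odd_cycle_condition ends" and "\<pi> permutes X" "finite X"
    and "\<forall>p\<in>X. adj ends (l p) (l (\<pi> p))"
  shows "in_semigroup_up_to_odd ends (\<Sum>p\<in>X. unit_exp (l p))"
proof -
  have "cycle_decomp X \<pi>" by (rule cycle_decomposition) fact+
  then show ?thesis using assms(4)
  proof (induction rule: cycle_decomp.induct)
    case empty
    then show ?case by (simp add: in_semigroup_up_to_odd_def zero_in_edge_semigroup)
  next
    case (comp I p cs)
    have perm: "p permutes I" using comp.hyps(1) cycle_decomp_permutes by blast
    have "adj ends (l q) (l (p q))" if "q \<in> I" for q
    proof -
      have "p q \<in> I" using perm that by (simp add: permutes_in_image)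
      then have "p q \<notin> set cs" using comp.hyps(3) by blast
      moreover have "adj ends (l q) (l ((cycle_of_list cs \<circ> p) q))" using comp.prems that by blast
      ultimately show ?thesis by (simp add: id_outside_supp)
    qed
    then have IH: "in_semigroup_up_to_odd ends (\<Sum>q\<in>I. unit_exp (l q))" using comp.IH by blast
    have adj_cs: "adj ends (l q) (l (cycle_of_list cs q))" if "q \<in> set cs" for q
    proof -
      have "p q = q" using perm that comp.hyps(3) by (auto simp: permutes_def)
      moreover have "adj ends (l q) (l ((cycle_of_list cs \<circ> p) q))" using comp.prems that by blast
      ultimately show ?thesis by simp
    qed
    have fin: "finite I" using comp.hyps(1) cycle_decomp_permutes by blast
    show ?case
    proof (cases "cs = []")
      case True
      then show ?thesis using IH by simp
    next
      case False
      \<comment> \<open>\<open>cycle_of_list\<close> sends each entry to its cyclic successor; the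
        last entry goes to the first, which yields the closing edge of the walk.\<close>
      have rot: "map (cycle_of_list cs) cs = rotate1 cs"
        using cyclic_rotation[OF comp.hyps(2), of "Suc 0"] by simp
      have "adj ends ((map l cs @ [hd (map l cs)]) ! i) ((map l cs @ [hd (map l cs)]) ! Suc i)"
        if i: "Suc i < length (map l cs @ [hd (map l cs)])" for i
      proof -
        have "i < length cs" using i by simp
        have "(map l cs @ [hd (map l cs)]) ! Suc i = l ((cs @ [hd cs]) ! Suc i)"
          using i False by (metis hd_map length_map list.simps(8,9) map_append nth_map)
        also have "(cs @ [hd cs]) ! Suc i = rotate1 cs ! i"
          using False by (cases cs) auto
        also have "\<dots> = cycle_of_list cs (cs ! i)" using \<open>i < length cs\<close> by (simp flip: rot)
        finally show ?thesis
          using adj_cs[of "cs ! i"] \<open>i < length cs\<close> by (simp add: nth_append)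
      qed
      then have "closed_walk ends (map l cs)"
        using False by (auto simp: closed_walk_def successively_conv_nth)
      then have "in_semigroup_up_to_odd ends (list_exp (map l cs) + (\<Sum>q\<in>I. unit_exp (l q)))"
        using occ IH by (intro in_semigroup_up_to_odd_add_walk)
      moreover have "(\<Sum>q\<in>set cs \<union> I. unit_exp (l q)) = (\<Sum>q\<in>set cs. unit_exp (l q)) + (\<Sum>q\<in>I. unit_exp (l q))"
        using comp.hyps(3) fin by (intro sum.union_disjoint) auto
      moreover have "(\<Sum>q\<in>set cs. unit_exp (l q)) = list_exp (map l cs)"
        using comp.hyps(2) by (simp add: list_exp_def sum.distinct_set_conv_list comp_def)
      ultimately show ?thesis by simp
    qed
  qed
qed

section \<open>Hall's condition for the edge semigroup\<close>

definition total_degree :: "('v::finite \<Rightarrow>\<^sub>0 nat) \<Rightarrow> nat" where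
  "total_degree x = (\<Sum>v\<in>UNIV. lookup x v)"

lemma total_degree_add: "total_degree (x + y) = total_degree x + total_degree y"
  by (simp add: total_degree_def lookup_add sum.distrib)

lemma total_degree_list_exp: "total_degree (list_exp c) = length c"
  by (induction c) (simp_all add: total_degree_def lookup_add sum.distrib lookup_single when_def)

lemma total_degree_edge_semigroup_even:
  fixes ends :: "'e::finite \<Rightarrow> 'v::finite set"
  assumes "simple_graph ends" "x \<in> edge_semigroup ends"
  shows "even (total_degree x)"
proof -
  obtain u where u: "x = vertex_exp ends u" using assms(2) by (auto simp: edge_semigroup_def)
  have "leaving ends UNIV u = 0" by (rule leaving_eq_0[OF assms(1)]) simp
  then show ?thesis using leaving_parity[OF assms(1), of UNIV u] by (simp add: total_degree_def u)
qed

definition neighbours :: "('e \<Rightarrow> 'v set) \<Rightarrow> 'v set \<Rightarrow> 'v set" where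
  "neighbours ends T = {w. \<exists>v\<in>T. adj ends v w}"

text \<open>An end of an edge in \<open>T\<close> makes the other end a neighbour, so each edge has
  at least as many ends in the neighbourhood as in \<open>T\<close>.\<close>

lemma sum_vertex_exp_le_neighbours:
  fixes ends :: "'e::finite \<Rightarrow> 'v::finite set"
  assumes sg: "simple_graph ends"
  shows "(\<Sum>v\<in>T. lookup (vertex_exp ends u) v) \<le> (\<Sum>v\<in>neighbours ends T. lookup (vertex_exp ends u) v)"
proof -
  have "card (ends e \<inter> T) \<le> card (ends e \<inter> neighbours ends T)" for e
  proof -
    obtain v w where e: "ends e = {v, w}" "v \<noteq> w" using sg by (rule simple_graph_edgeE)
    have "adj ends v w" "adj ends w v" using e by (auto simp: adj_def insert_commute)
    then have "v \<in> T \<Longrightarrow> w \<in> neighbours ends T" "w \<in> T \<Longrightarrow> v \<in> neighbours ends T"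
      by (auto simp: neighbours_def)
    then show ?thesis using e by (cases "v \<in> T"; cases "w \<in> T") (auto simp: card_insert_if Int_insert_left)
  qed
  then show ?thesis unfolding sum_vertex_exp_eq by (intro sum_mono mult_right_mono) auto
qed

text \<open>Hall's theorem assigns to each unit of \<open>x\<close> at a vertex a unit at an
  adjacent vertex, injectively and therefore as a permutation. Its cycles are closed walks with
  exponent sum \<open>x\<close>, and an odd walk left over would contradict parity.\<close>

lemma edge_semigroup_Hall:
  fixes ends :: "'e::finite \<Rightarrow> 'v::finite set"
  assumes sg: "simple_graph ends" and occ: "odd_cycle_condition ends"
    and even: "even (total_degree x)"
    and hall: "\<And>T. (\<Sum>v\<in>T. lookup x v) \<le> (\<Sum>v\<in>neighbours ends T. lookup x v)"
  shows "x \<in> edge_semigroup ends"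
proof -
  define copies where "copies T = (SIGMA v:T. {..<lookup x v})" for T
  define X where "X = copies UNIV"
  have card_copies: "card (copies T) = (\<Sum>v\<in>T. lookup x v)" for T
    unfolding copies_def by (subst card_SigmaI) auto
  have fin: "finite (copies T)" for T by (auto simp: copies_def)
  have "\<exists>f. inj_on f X \<and> (\<forall>p\<in>X. f p \<in> copies (neighbours ends {fst p}))"
  proof (rule hall_marriage)
    fix J assume J: "J \<subseteq> X"
    \<comment> \<open>Copies of a vertex share their neighbourhood, so it suffices to check Hall's
      condition for full sets of copies.\<close>
    have "J \<subseteq> copies (fst ` J)" using J by (force simp: X_def copies_def)
    then have "card J \<le> card (copies (fst ` J))" using fin by (rule card_mono[rotated])
    also have "\<dots> \<le> card (copies (neighbours ends (fst ` J)))"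
      unfolding card_copies by (rule hall)
    also have "copies (neighbours ends (fst ` J)) = (\<Union>p\<in>J. copies (neighbours ends {fst p}))"
      by (auto simp: copies_def neighbours_def)
    finally show "card J \<le> card (\<Union>p\<in>J. copies (neighbours ends {fst p}))" .
  qed (simp_all add: X_def fin)
  then obtain f where f: "inj_on f X" "\<And>p. p \<in> X \<Longrightarrow> f p \<in> copies (neighbours ends {fst p})" by blast
  have "copies T \<subseteq> X" for T by (auto simp: X_def copies_def)
  then have fX: "f ` X \<subseteq> X" using f(2) by blast
  have "bij_betw f X X"
    using f(1) endo_inj_surj[OF _ fX f(1)] fin by (auto simp: bij_betw_def X_def)
  define \<pi> where "\<pi> p = (if p \<in> X then f p else p)" for p
  have "bij_betw \<pi> X X" using \<open>bij_betw f X X\<close> by (rule bij_betw_cong[THEN iffD1, rotated]) (simp add: \<pi>_def)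
  then have "\<pi> permutes X" by (rule bij_imp_permutes) (simp add: \<pi>_def)
  moreover have "adj ends (fst p) (fst (\<pi> p))" if "p \<in> X" for p
    using f(2)[OF that] that by (auto simp: \<pi>_def copies_def neighbours_def)
  ultimately have "in_semigroup_up_to_odd ends (\<Sum>p\<in>X. unit_exp (fst p))"
    using fin occ by (intro permutation_exponent) (auto simp: X_def)
  also have "(\<Sum>p\<in>X. unit_exp (fst p)) = x"
  proof (rule poly_mapping_eqI)
    fix v
    have "lookup (\<Sum>p\<in>X. unit_exp (fst p)) v = (\<Sum>p\<in>X. if fst p = v then 1 else 0)"
      by (simp add: lookup_sum lookup_single when_def)
    also have "\<dots> = card (X \<inter> {p. fst p = v})"
      using fin by (simp add: sum.If_cases X_def)
    also have "X \<inter> {p. fst p = v} = copies {v}" by (auto simp: X_def copies_def)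
    finally show "lookup (\<Sum>p\<in>X. unit_exp (fst p)) v = lookup x v" by (simp add: card_copies)
  qed
  finally have "in_semigroup_up_to_odd ends x" .
  moreover have False if "closed_walk ends c" "odd (length c)" "s \<in> edge_semigroup ends" "x = list_exp c + s" for c s
    using that even total_degree_edge_semigroup_even[OF sg that(3)]
    by (simp add: total_degree_add total_degree_list_exp)
  ultimately show ?thesis unfolding in_semigroup_up_to_odd_def by blast
qed

subsection \<open>Normality of the edge ring\<close>

lemma edge_ring_0: "0 \<in> edge_ring ends"
  using edge_ring.const[of 0 ends] by simp

lemma edge_ring_sum: "(\<And>i. i \<in> A \<Longrightarrow> f i \<in> edge_ring ends) \<Longrightarrow> sum f A \<in> edge_ring ends"
  by (induction A rule: infinite_finite_induct) (auto intro: edge_ring_0 edge_ring.add)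

text \<open>Identifies the edge ring with the semigroup ring of \<open>edge_semigroup\<close>, so
  that membership is read off from exponents.\<close>

lemma edge_ring_iff:
  fixes ends :: "'e::finite \<Rightarrow> 'v::finite set" and p :: "('v, 'k::field) mpoly"
  shows "p \<in> edge_ring ends \<longleftrightarrow> keys p \<subseteq> edge_semigroup ends"
proof
  assume "p \<in> edge_ring ends"
  then show "keys p \<subseteq> edge_semigroup ends"
  proof induction
    case (const c)
    show ?case using zero_in_edge_semigroup[of ends] by (auto split: if_splits)
  next
    case (gen e)
    have "vertex_exp ends (single e 1) \<in> edge_semigroup ends" by (auto simp: edge_semigroup_def)
    then show ?case by (simp add: vertex_exp_single)
  next
    case (add p q)
    then show ?case using keys_add[of p q] by blast
  next
    case (mult p q)
    then show ?case using keys_mult[of p q] add_in_edge_semigroup[of _ ends] by blast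
  qed
next
  assume keys: "keys p \<subseteq> edge_semigroup ends"
  have mono: "single (vertex_exp ends u) (1::'k) \<in> edge_ring ends" for u
  proof (induction u rule: poly_mapping_add_induct)
    case (single e n)
    show ?case
    proof (induction n)
      case 0
      then show ?case using edge_ring.const[of 1 ends] by simp
    next
      case (Suc n)
      have "single (vertex_exp ends (single e (Suc n))) (1::'k) =
          single (vertex_exp ends (single e 1)) 1 * single (vertex_exp ends (single e n)) 1"
        by (simp add: mult_single One_nat_def flip: vertex_exp_add single_add)
      also have "\<dots> \<in> edge_ring ends"
        using edge_ring.gen[of ends e] Suc by (auto intro: edge_ring.mult simp: vertex_exp_single)
      finally show ?case .
    qed
  next
    case (add u w)
    then have "single (vertex_exp ends u) (1::'k) * single (vertex_exp ends w) 1 \<in> edge_ring ends"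
      by (rule edge_ring.mult)
    then show ?case by (simp add: mult_single vertex_exp_add)
  qed
  have "single a k \<in> edge_ring ends" if aS: "a \<in> edge_semigroup ends" for a and k :: 'k
  proof -
    obtain u where "a = vertex_exp ends u" using aS by (auto simp: edge_semigroup_def)
    then have "single 0 k * single a 1 \<in> edge_ring ends"
      using mono[of u] by (auto intro: edge_ring.mult edge_ring.const)
    then show ?thesis by (simp add: mult_single)
  qed
  then have "(\<Sum>a\<in>keys p. single a (lookup p a)) \<in> edge_ring ends"
    using keys by (intro edge_ring_sum) blast
  then show "p \<in> edge_ring ends" by (simp add: sum_single_keys)
qed

lemma edge_ring_1: "1 \<in> edge_ring ends"
  using edge_ring.const[of 1 ends] by simp

lemma edge_ring_uminus: "p \<in> edge_ring ends \<Longrightarrow> - p \<in> edge_ring ends"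
proof -
  assume "p \<in> edge_ring ends"
  then have "single 0 (- 1) * p \<in> edge_ring ends" by (intro edge_ring.mult edge_ring.const)
  then show ?thesis by (simp add: single_uminus)
qed

lemma edge_ring_power: "p \<in> edge_ring ends \<Longrightarrow> p ^ n \<in> edge_ring ends"
  by (induction n) (auto intro: edge_ring_1 edge_ring.mult)

lemma edge_ring_of_nat: "of_nat n \<in> edge_ring ends"
  by (induction n) (auto intro: edge_ring_0 edge_ring_1 edge_ring.add)

section \<open>Leading exponents of almost integral fractions\<close>

lemma mpoly_power_nonzero:
  fixes p :: "('v::finite, 'k::field) mpoly"
  shows "p \<noteq> 0 \<Longrightarrow> p ^ n \<noteq> 0"
  by (induction n) (auto simp: mpoly_no_zero_divisors)

lemma lookup_lead_exp_power:
  fixes p :: "('v::finite, 'k::field) mpoly"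
  assumes "p \<noteq> 0"
  shows "lookup (lead_exp (p ^ n)) v = n * lookup (lead_exp p) v"
proof (induction n)
  case 0
  have "lead_exp (1 :: ('v, 'k) mpoly) = 0" by (rule lead_exp_eqI) auto
  then show ?case by simp
next
  case (Suc n)
  then show ?case
    using lead_exp_mult[OF assms mpoly_power_nonzero[OF assms]] by (simp add: lookup_add)
qed

text \<open>Replaces dividing by \<open>m\<close> and letting \<open>m\<close> grow: at
  \<open>m = q + 1\<close> the constant \<open>q\<close> is already too small to compensate.\<close>

lemma le_of_multiples_le:
  fixes p q r :: nat
  assumes "\<And>m. m * p \<le> q + m * r"
  shows "p \<le> r"
proof (rule ccontr)
  assume "\<not> p \<le> r"
  then have "Suc r \<le> p" by simp
  then have "Suc q * Suc r \<le> Suc q * p" by (intro mult_left_mono) auto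
  then show False using assms[of "Suc q"] by simp
qed

text \<open>With \<open>x\<close> the difference of the leading exponents, comparing leading terms
  puts \<open>lead_exp c + m * x\<close> in the edge semigroup for all \<open>m\<close>. The
  neighbourhood inequalities pass to \<open>x\<close>, as the fixed summand becomes negligible, and
  \<open>edge_semigroup_Hall\<close> turns them into membership.\<close>

lemma lead_exp_diff_in_edge_semigroup:
  fixes ends :: "'e::finite \<Rightarrow> 'v::finite set" and a b c :: "('v, 'k::field) mpoly"
  assumes sg: "simple_graph ends" and occ: "odd_cycle_condition ends"
    and a: "a \<in> edge_ring ends" "a \<noteq> 0" and b: "b \<in> edge_ring ends" "b \<noteq> 0" and c: "c \<noteq> 0"
    and almost: "\<And>m. \<exists>s\<in>edge_ring ends. c * a ^ m = b ^ m * s"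
  obtains x where "x \<in> edge_semigroup ends" "lead_exp a = x + lead_exp b"
proof -
  have rep: "\<exists>u. \<forall>v. m * lookup (lead_exp b) v + lookup (vertex_exp ends u) v =
      lookup (lead_exp c) v + m * lookup (lead_exp a) v" for m
  proof -
    obtain s where s: "s \<in> edge_ring ends" "c * a ^ m = b ^ m * s" using almost by blast
    have "c * a ^ m \<noteq> 0" using c a(2) by (intro mpoly_no_zero_divisors mpoly_power_nonzero)
    then have s0: "s \<noteq> 0" using s by auto
    have "lead_exp c + lead_exp (a ^ m) = lead_exp (b ^ m) + lead_exp s"
      using arg_cong[OF s(2), of lead_exp] lead_exp_mult[OF c mpoly_power_nonzero[OF a(2), of m]]
        lead_exp_mult[OF mpoly_power_nonzero[OF b(2), of m] s0] by simp
    moreover have "lead_exp s \<in> edge_semigroup ends"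
      using s(1) lead_exp(1)[OF s0] by (auto simp: edge_ring_iff)
    then obtain u where "lead_exp s = vertex_exp ends u" by (auto simp: edge_semigroup_def)
    ultimately have "lookup (lead_exp c + lead_exp (a ^ m)) v = lookup (lead_exp (b ^ m) + vertex_exp ends u) v" for v
      by simp
    then show ?thesis
      using lookup_lead_exp_power[OF a(2), of m] lookup_lead_exp_power[OF b(2), of m]
      by (intro exI[of _ u]) (simp add: lookup_add)
  qed
  \<comment> \<open>Subtraction of natural numbers truncates; \<open>le\<close> shows that it does
    not do so here.\<close>
  define x where "x = lead_exp a - lead_exp b"
  have le: "lookup (lead_exp b) v \<le> lookup (lead_exp a) v" for v
  proof (rule le_of_multiples_le[of _ "lookup (lead_exp c) v"])
    fix m
    obtain u where "m * lookup (lead_exp b) v + lookup (vertex_exp ends u) v =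
      lookup (lead_exp c) v + m * lookup (lead_exp a) v" using rep[of m] by blast
    then show "m * lookup (lead_exp b) v \<le> lookup (lead_exp c) v + m * lookup (lead_exp a) v" by linarith
  qed
  have ax: "lead_exp a = x + lead_exp b"
    using le by (intro poly_mapping_eqI) (simp add: x_def lookup_add lookup_minus)
  have rep': "\<exists>u. \<forall>v. lookup (vertex_exp ends u) v = lookup (lead_exp c) v + m * lookup x v" for m
  proof -
    obtain u where "\<forall>v. m * lookup (lead_exp b) v + lookup (vertex_exp ends u) v =
      lookup (lead_exp c) v + m * lookup (lead_exp a) v" using rep[of m] by blast
    then show ?thesis unfolding ax lookup_add by (intro exI[of _ u]) (simp add: distrib_left)
  qed
  have "x \<in> edge_semigroup ends"
  proof (rule edge_semigroup_Hall[OF sg occ])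
    have "lead_exp a \<in> edge_semigroup ends" "lead_exp b \<in> edge_semigroup ends"
      using a b lead_exp(1) by (auto simp: edge_ring_iff)
    then have "even (total_degree (lead_exp a))" "even (total_degree (lead_exp b))"
      using total_degree_edge_semigroup_even[OF sg] by auto
    then show "even (total_degree x)" by (simp add: ax total_degree_add)
  next
    fix T
    let ?N = "neighbours ends T"
    show "(\<Sum>v\<in>T. lookup x v) \<le> (\<Sum>v\<in>?N. lookup x v)"
    proof (rule le_of_multiples_le[of _ "\<Sum>v\<in>?N. lookup (lead_exp c) v"])
      fix m
      obtain u where u: "\<And>v. lookup (vertex_exp ends u) v = lookup (lead_exp c) v + m * lookup x v"
        using rep'[of m] by blast
      show "m * (\<Sum>v\<in>T. lookup x v) \<le> (\<Sum>v\<in>?N. lookup (lead_exp c) v) + m * (\<Sum>v\<in>?N. lookup x v)"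
        using sum_vertex_exp_le_neighbours[OF sg, of u T]
        by (simp add: u sum.distrib flip: sum_distrib_left)
    qed
  qed
  then show thesis using ax that by blast
qed

text \<open>Subtracting a monomial multiple of \<open>b\<close> kills the leading term of
  \<open>a\<close>, keeps the fraction almost integral and lowers the leading exponent. Only
  finitely many exponents lie below a given one, so this ends.\<close>

lemma edge_ring_almost_integral:
  fixes ends :: "'e::finite \<Rightarrow> 'v::finite set" and a b c :: "('v, 'k::field) mpoly"
  assumes sg: "simple_graph ends" and occ: "odd_cycle_condition ends"
    and b: "b \<in> edge_ring ends" "b \<noteq> 0" and c: "c \<noteq> 0"
    and "a \<in> edge_ring ends" "\<And>m. \<exists>s\<in>edge_ring ends. c * a ^ m = b ^ m * s"
  shows "\<exists>d\<in>edge_ring ends. a = b * d"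
  using assms(6,7)
proof (induction "card {y :: 'v \<Rightarrow>\<^sub>0 nat. grlex_key y < grlex_key (lead_exp a)}" arbitrary: a rule: less_induct)
  case less
  note a = less.prems(1) and almost = less.prems(2)
  show ?case
  proof (cases "a = 0")
    case True
    then show ?thesis using edge_ring_0[of ends] by (intro bexI[of _ 0]) auto
  next
    case False
    obtain x where x: "x \<in> edge_semigroup ends" "lead_exp a = x + lead_exp b"
      using lead_exp_diff_in_edge_semigroup[OF sg occ a False b c almost] by blast
    define k where "k = lookup a (lead_exp a) / lookup b (lead_exp b)"
    define t where "t = single x k"
    have lb: "lookup b (lead_exp b) \<noteq> 0" using lead_exp(1)[OF b(2)] by (simp add: in_keys_iff)
    have "k \<noteq> 0" using lb lead_exp(1)[OF False] by (simp add: k_def in_keys_iff)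
    then have kt: "keys t = {x}" by (simp add: t_def)
    have t0: "t \<noteq> 0" "lead_exp t = x"
      using kt by force (rule lead_exp_eqI, simp_all add: kt)
    have t: "t \<in> edge_ring ends" using x(1) by (auto simp: edge_ring_iff t_def split: if_splits)
    have ltb: "lead_exp (t * b) = lead_exp a" using lead_exp_mult[OF t0(1) b(2)] t0(2) x(2) by simp
    have "lookup (t * b) (lead_exp a) = lookup a (lead_exp a)"
      using lookup_mult_lead_exp[OF t0(1) b(2)] lb t0(2) by (simp add: x(2)[symmetric]) (simp add: t_def k_def)
    define a' where "a' = a + (- t) * b"
    have a'_zero: "lookup a' (lead_exp a) = 0"
      using \<open>lookup (t * b) (lead_exp a) = lookup a (lead_exp a)\<close> by (simp add: a'_def lookup_minus)
    have a': "a' \<in> edge_ring ends"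
      unfolding a'_def by (intro edge_ring.add edge_ring.mult edge_ring_uminus a t b)
    have "\<exists>s\<in>edge_ring ends. c * a' ^ m = b ^ m * s" for m
    proof -
      obtain s where s: "\<And>i. s i \<in> edge_ring ends" "\<And>i. c * a ^ i = b ^ i * s i" using almost by metis
      \<comment> \<open>From the binomial expansion of \<open>a' ^ m\<close>: each summand carries
        \<open>b ^ i\<close> by the relation for \<open>a ^ i\<close>, and
        \<open>b ^ (m - i)\<close> from the power of \<open>(- t) * b\<close>.\<close>
      define r where "r = (\<Sum>i\<le>m. of_nat (m choose i) * s i * (- t) ^ (m - i))"
      have "c * a' ^ m = (\<Sum>i\<le>m. of_nat (m choose i) * (c * a ^ i) * ((- t) ^ (m - i) * b ^ (m - i)))"
        unfolding a'_def binomial_ring power_mult_distrib sum_distrib_left by (intro sum.cong) (simp_all only: mult_ac)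
      also have "\<dots> = (\<Sum>i\<le>m. (b ^ i * b ^ (m - i)) * (of_nat (m choose i) * s i * (- t) ^ (m - i)))"
        unfolding s(2) by (intro sum.cong) (simp_all only: mult_ac)
      also have "\<dots> = b ^ m * r"
        unfolding r_def sum_distrib_left by (intro sum.cong refl) (simp flip: power_add)
      finally have "c * a' ^ m = b ^ m * r" .
      moreover have "r \<in> edge_ring ends"
        unfolding r_def by (intro edge_ring_sum edge_ring.mult edge_ring_of_nat s edge_ring_power edge_ring_uminus t)
      ultimately show ?thesis by blast
    qed
    note almost' = this
    have "\<exists>d\<in>edge_ring ends. a' = b * d"
    proof (cases "a' = 0")
      case True
      then show ?thesis using edge_ring_0[of ends] by (intro bexI[of _ 0]) auto
    next
      case a'0: False
      have "lead_exp a' \<in> keys a \<union> keys (t * b)"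
        using lead_exp(1)[OF a'0] by (auto simp: a'_def in_keys_iff lookup_add lookup_minus)
      then have "grlex_key (lead_exp a') \<le> grlex_key (lead_exp a)"
        using lead_exp(2)[OF False] lead_exp(2)[OF mpoly_no_zero_divisors[OF t0(1) b(2)]] ltb by auto
      moreover have "lead_exp a' \<noteq> lead_exp a"
        using a'_zero lead_exp(1)[OF a'0] by (auto simp: in_keys_iff)
      ultimately have lt: "grlex_key (lead_exp a') < grlex_key (lead_exp a)"
        using injD[OF inj_grlex_key] by (metis order_le_less)
      define below where "below z = {y :: 'v \<Rightarrow>\<^sub>0 nat. grlex_key y < z}" for z :: "nat \<Rightarrow>\<^sub>0 nat"
      have "below (grlex_key (lead_exp a')) \<subseteq> below (grlex_key (lead_exp a))"
        using lt by (auto simp: below_def dest: order.strict_trans)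
      moreover have "lead_exp a' \<in> below (grlex_key (lead_exp a))" "lead_exp a' \<notin> below (grlex_key (lead_exp a'))"
        using lt by (simp_all add: below_def)
      ultimately have "below (grlex_key (lead_exp a')) \<subset> below (grlex_key (lead_exp a))" by blast
      then have "card (below (grlex_key (lead_exp a'))) < card (below (grlex_key (lead_exp a)))"
        by (rule psubset_card_mono[rotated]) (simp add: below_def finite_grlex_below)
      from less.hyps[OF this[unfolded below_def] a' almost'] show ?thesis .
    qed
    then obtain d where d: "d \<in> edge_ring ends" "a' = b * d" by blast
    have "a = a' + t * b" by (simp add: a'_def)
    also have "\<dots> = b * (d + t)" by (simp add: d algebra_simps)
    finally show ?thesis using d t by (blast intro: edge_ring.add)
  qed
qed

theorem normal_edge_ring:
  fixes ends :: "'e::finite \<Rightarrow> 'v::finite set"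
  assumes sg: "simple_graph ends" and occ: "odd_cycle_condition ends"
  shows "normal_subring (edge_ring ends :: ('v, 'k::field) mpoly set)"
  unfolding normal_subring_def
proof (intro ballI impI)
  fix a b :: "('v, 'k) mpoly"
  assume a: "a \<in> edge_ring ends" and b: "b \<in> edge_ring ends" "b \<noteq> 0"
    and "\<exists>n>0. \<exists>c. (\<forall>i<n. c i \<in> edge_ring ends) \<and> a ^ n + (\<Sum>i<n. c i * a ^ i * b ^ (n - i)) = 0"
  then obtain n c where c: "\<And>i. i < n \<Longrightarrow> c i \<in> edge_ring ends"
    and eq: "a ^ n + (\<Sum>i<n. c i * a ^ i * b ^ (n - i)) = 0" by blast
  \<comment> \<open>An integral fraction is almost integral with common denominator
    \<open>b ^ n\<close>: for \<open>m \<ge> n\<close> the monic equation rewrites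
    \<open>a ^ m\<close> through lower powers of \<open>a\<close>.\<close>
  have "\<exists>s\<in>edge_ring ends. b ^ n * a ^ m = b ^ m * s" for m
  proof (induction m rule: less_induct)
    case (less m)
    show ?case
    proof (cases "m < n")
      case True
      then have "b ^ n = b ^ m * b ^ (n - m)" by (simp flip: power_add)
      then have "b ^ n * a ^ m = b ^ m * (b ^ (n - m) * a ^ m)" by (simp only: mult.assoc)
      then show ?thesis using a b by (blast intro: edge_ring.mult edge_ring_power)
    next
      case False
      \<comment> \<open>The power of \<open>a\<close> in the \<open>i\<close>-th term once the
        equation is multiplied by \<open>a ^ (m - n)\<close>; the accompanying
        \<open>b ^ (n - i)\<close> fills the gap between \<open>b ^ j i\<close> and
        \<open>b ^ m\<close>.\<close>
      define j where "j i = m - (n - i)" for i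
      have "\<exists>s\<in>edge_ring ends. b ^ n * a ^ j i = b ^ j i * s" if "i < n" for i
        using that False by (intro less.IH) (simp add: j_def)
      then obtain s where s: "\<And>i. i < n \<Longrightarrow> s i \<in> edge_ring ends"
        "\<And>i. i < n \<Longrightarrow> b ^ n * a ^ j i = b ^ j i * s i" by metis
      have "a ^ n = - (\<Sum>i<n. c i * a ^ i * b ^ (n - i))" using eq by (simp add: eq_neg_iff_add_eq_0)
      then have "b ^ n * a ^ m = - (\<Sum>i<n. c i * a ^ i * b ^ (n - i)) * (b ^ n * a ^ (m - n))"
        using False by (metis le_add_diff_inverse linorder_not_less mult.left_commute power_add)
      also have "\<dots> = - (\<Sum>i<n. c i * b ^ (n - i) * (b ^ n * a ^ j i))"
      proof -
        have "c i * a ^ i * b ^ (n - i) * (b ^ n * a ^ (m - n)) = c i * b ^ (n - i) * (b ^ n * a ^ j i)" if "i < n" for i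
        proof -
          have "j i = i + (m - n)" using that False by (simp add: j_def)
          then have "a ^ j i = a ^ i * a ^ (m - n)" by (simp add: power_add)
          then show ?thesis by (simp only: mult_ac)
        qed
        then show ?thesis by (simp add: sum_distrib_right)
      qed
      also have "\<dots> = - (\<Sum>i<n. b ^ m * (c i * s i))"
      proof -
        have "c i * b ^ (n - i) * (b ^ n * a ^ j i) = b ^ m * (c i * s i)" if "i < n" for i
        proof -
          have "m = (n - i) + j i" using that False by (simp add: j_def)
          then have "b ^ m = b ^ (n - i) * b ^ j i" by (metis power_add)
          then show ?thesis unfolding s(2)[OF that] by (simp only: mult_ac)
        qed
        then show ?thesis by simp
      qed
      also have "\<dots> = b ^ m * (- (\<Sum>i<n. c i * s i))" by (simp add: sum_distrib_left)
      finally show ?thesis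
        using c s(1) by (blast intro: edge_ring_uminus edge_ring_sum edge_ring.mult)
    qed
  qed
  then show "\<exists>d\<in>edge_ring ends. a = b * d"
    using edge_ring_almost_integral[OF sg occ b mpoly_power_nonzero[OF b(2), of n] a] by blast
qed

theorem theorem6p3:
  fixes ends :: "'e::finite \<Rightarrow> 'v::finite set"
  assumes "simple_graph ends"
    and "biconnected ends"
    and "complete_intersection ends TYPE('k::field)"
  shows "odd_cycle_condition ends \<and> normal_subring (edge_ring ends :: ('v, 'k) mpoly set)"
proof -
  have "odd_cycle_condition ends"
    using assms by (rule odd_cycle_condition_of_complete_intersection)
  with assms(1) show ?thesis using normal_edge_ring by blast
qed

end
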